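(* Let $\mathcal G=([m],E)$ be a directed tree with the constant coloring $c^*$ and let $\mathfrak I_m=\{(i,j):1\le i\le j\le m\}$. For each $0\le d\le 2h(\mathcal G)$, choose $\emptyset\ne S_d\subseteq\mathfrak I_m$ with $\bigwedge_{(i,j)\in S_d}t(i,j)=[h]^w\in P_{\mathcal G}$, where $[h]^w$ is the least element of $P_{\mathcal G}$ satisfying $2h+w=d$, and choose $\emptyset\ne S_d'\subseteq\mathfrak I_m$ satisfying $\bigwedge_{(i,j)\in S_d'}t(i,j)=[h-1]^w$ (with the convention $z_{S_d'}:=0$ if $h=0$). Then $$I_{\hat\varphi}=\big\langle (z_{S_i}-z_{S_i'})(z_{S_j}-z_{S_j'})-(z_{S_{i-1}}-z_{S_{i-1}'})(z_{S_{j+1}}-z_{S_{j+1}'}) : 1\le i\le j\le 2h(\mathcal G)-1\big\rangle+\langle L_{\mathcal G}\rangle,$$ where $L_{\mathcal G}$ denotes the linear forms, listed in the context, defining the linear span of $\mathcal V_{\hat\varphi}$.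
   Context: A directed tree $\mathcal G=([m],E)$ is a directed acyclic graph on $[m]=\{1,\dots,m\}$ whose underlying undirected graph is a tree and which has a unique source node. $h(\mathcal G)$ is the length of the longest directed path in $\mathcal G$. A trek between $i$ and $j$ is a pair $T=\{P,Q\}$ of directed paths (length zero allowed) with a common starting node, $P$ ending at $i$ and $Q$ ending at $j$; its length is $|P|+|Q|$ (number of edges). Let $N$ be the length of the longest trek in $\mathcal G$. For $i,j\in[m]$, $t(i,j)\in\mathbb Z_{\ge0}^{\{0,\dots,N\}}$ is the vector whose $k$-th entry is the number of treks between $i$ and $j$ of length $k$ (the coefficient of $\omega\lambda^k$ in the trek polynomial under the constant coloring $c^*$, in which all vertices share one parameter $\omega$ and all edges share one parameter $\lambda$). $P_{\mathcal G}$ is the poset of all coordinatewise minima $\bigwedge_{(i,j)\in S}t(i,j)$, $\emptyset\ne S\subseteq\mathfrak I_m$, under the coordinatewise order $\preceq$; $\wedge,\vee$ denote coordinatewise minimum and maximum. $[h]^w$ denotes the $0/1$ vector with ones exactly in positions $w,w+2,\dots,w+2h$. The map $\hat\varphi$ sends $(\omega,\lambda)\in\mathbb R^2$ to the point with coordinates $z_S$, $\emptyset\ne S\subseteq\mathfrak I_m$, where $z_S=\sum_{k=0}^N a_k\omega\lambda^k$ with $(a_k)_k=\bigwedge_{(i,j)\in S}t(i,j)$. $\mathcal V_{\hat\varphi}$ is the Zariski closure of its image and $I_{\hat\varphi}\subseteq\mathbb R[z_S:\emptyset\ne S\subseteq\mathfrak I_m]$ is its vanishing ideal. The residue vector of $s\in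 P_{\mathcal G}$ is $r(s)=s-\bigvee_{s'\prec s}s'$ (empty join $=0$). The set $L_{\mathcal G}$ consists of: the forms $z_S-z_{S'}$ when $\bigwedge_{(i,j)\in S}t(i,j)=\bigwedge_{(i,j)\in S'}t(i,j)$; and the forms $z_S-z_{S_1}-z_{S_2}+z_{S_3}$ where $s=\bigwedge_{(i,j)\in S}t(i,j)$ satisfies $r(s)=0$, the elements $s_1=\bigwedge_{(i,j)\in S_1}t(i,j)$, $s_2=\bigwedge_{(i,j)\in S_2}t(i,j)$ are the lower cover of $s$ in $P_{\mathcal G}$ (the set of elements covered by $s$), and $s_1\wedge s_2=\bigwedge_{(i,j)\in S_3}t(i,j)$.
   Formalization: L_G is enlarged by the forms z_S for which the minimum of t(i,j) over S is the zero vector (r(s)=0, empty lower cover); without them the claim fails for every m≥2, since z_S vanishes on the image but is not in the span of the listed forms. *)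

theory Defs
  imports
    "HOL-Algebra.Ideal"
    "HOL-Library.Poly_Mapping"
    "HOL-Library.FuncSet"
    "Graph_Theory.Digraph_Component"
begin

section \<open>Polynomial rings, vanishing ideals and Zariski closures over the reals\<close>

text \<open>A monomial is a finitely supported exponent function and a polynomial a finitely
  supported coefficient function on monomials. The ring \<open>\<real>[z\<^sub>v : v \<in> V]\<close> consists of the
  polynomials all of whose monomials involve only variables in \<open>V\<close>.\<close>

type_synonym 'v mpoly = "('v \<Rightarrow>\<^sub>0 nat) \<Rightarrow>\<^sub>0 real"

definition poly_ring :: "'v set \<Rightarrow> 'v mpoly ring" where
  "poly_ring V = \<lparr> carrier = {p. \<forall>u \<in> Poly_Mapping.keys p. Poly_Mapping.keys u \<subseteq> V},
     monoid.mult = (*), one = 1, zero = 0, add = (+) \<rparr>"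

definition var :: "'v \<Rightarrow> 'v mpoly" where
  "var v = Poly_Mapping.single (Poly_Mapping.single v 1) 1"

definition peval :: "('v \<Rightarrow> real) \<Rightarrow> 'v mpoly \<Rightarrow> real" where
  "peval a p = (\<Sum>u\<in>Poly_Mapping.keys p.
     Poly_Mapping.lookup p u * (\<Prod>v\<in>Poly_Mapping.keys u. a v ^ Poly_Mapping.lookup u v))"

definition vanishing_ideal :: "'v set \<Rightarrow> ('v \<Rightarrow> real) set \<Rightarrow> 'v mpoly set" where
  "vanishing_ideal V A = {p \<in> carrier (poly_ring V). \<forall>a\<in>A. peval a p = 0}"

text \<open>The affine space with coordinates \<open>V\<close> is \<open>V \<rightarrow>\<^sub>E UNIV\<close>.\<close>

definition zariski_closure :: "'v set \<Rightarrow> ('v \<Rightarrow> real) set \<Rightarrow> ('v \<Rightarrow> real) set" where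
  "zariski_closure V A =
     {x \<in> V \<rightarrow>\<^sub>E UNIV. \<forall>p \<in> vanishing_ideal V A. peval x p = 0}"

lemma poly_ring_simps [simp]:
  "x \<otimes>\<^bsub>poly_ring V\<^esub> y = x * y" "\<one>\<^bsub>poly_ring V\<^esub> = 1"
  "x \<oplus>\<^bsub>poly_ring V\<^esub> y = x + y" "\<zero>\<^bsub>poly_ring V\<^esub> = 0"
  by (simp_all add: poly_ring_def)

lemma poly_ring_closed:
  assumes "p \<in> carrier (poly_ring V)" "q \<in> carrier (poly_ring V)"
  shows "p + q \<in> carrier (poly_ring V)" "- p \<in> carrier (poly_ring V)"
    "p * q \<in> carrier (poly_ring V)"
proof -
  have p: "Poly_Mapping.keys u \<subseteq> V" if "u \<in> Poly_Mapping.keys p" for u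
    using assms(1) that by (simp add: poly_ring_def)
  have q: "Poly_Mapping.keys u \<subseteq> V" if "u \<in> Poly_Mapping.keys q" for u
    using assms(2) that by (simp add: poly_ring_def)
  have "Poly_Mapping.keys u \<subseteq> V" if "u \<in> Poly_Mapping.keys (p + q)" for u
    using that Poly_Mapping.keys_add[of p q] p q by blast
  then show "p + q \<in> carrier (poly_ring V)"
    by (simp add: poly_ring_def)
  show "- p \<in> carrier (poly_ring V)"
    using p by (simp add: poly_ring_def in_keys_iff)
  have "Poly_Mapping.keys u \<subseteq> V" if u: "u \<in> Poly_Mapping.keys (p * q)" for u
  proof -
    obtain a b where "u = a + b" "a \<in> Poly_Mapping.keys p" "b \<in> Poly_Mapping.keys q"
      using keys_mult[of p q] u by blast
    then show ?thesis
      using Poly_Mapping.keys_add[of a b] p[of a] q[of b] by blast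
  qed
  then show "p * q \<in> carrier (poly_ring V)"
    by (simp add: poly_ring_def)
qed

lemma cring_poly_ring: "cring (poly_ring V)"
proof (rule cringI)
  have zero_one: "0 \<in> carrier (poly_ring V)" "1 \<in> carrier (poly_ring V)"
    by (simp_all add: poly_ring_def)
  show "abelian_group (poly_ring V)"
  proof (rule abelian_groupI)
    fix p assume "p \<in> carrier (poly_ring V)"
    then show "\<exists>y\<in>carrier (poly_ring V). y \<oplus>\<^bsub>poly_ring V\<^esub> p = \<zero>\<^bsub>poly_ring V\<^esub>"
      using poly_ring_closed(2) by (intro bexI[of _ "- p"]) simp_all
  qed (simp_all add: poly_ring_closed zero_one ac_simps)
  show "comm_monoid (poly_ring V)"
    by (rule comm_monoidI) (simp_all add: poly_ring_closed zero_one ac_simps)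
qed (simp add: distrib_right)

section \<open>Directed trees and treks\<close>

abbreviation digraph_on :: "nat \<Rightarrow> (nat \<times> nat) set \<Rightarrow> (nat, nat \<times> nat) pre_digraph" where
  "digraph_on m E \<equiv> with_proj \<lparr> pverts = {1..m}, parcs = E \<rparr>"

text \<open>The underlying undirected graph is represented by its symmetric digraph. There, traversing
  an edge back and forth is formally a cycle of length two, so only cycles of length at least
  three count as undirected cycles; antiparallel edges are excluded by \<open>acyclic E\<close>.
  (The constants \<open>forest\<close> and \<open>tree\<close> of \<open>Graph_Theory\<close> only forbid directed cycles.)\<close>

definition directed_tree :: "nat \<Rightarrow> (nat \<times> nat) set \<Rightarrow> bool" where
  "directed_tree m E \<longleftrightarrow>
     wf_digraph (digraph_on m E) \<and>
     acyclic E \<and>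
     connected (digraph_on m E) \<and>
     \<not> (\<exists>p. pre_digraph.cycle (with_proj (mk_symmetric (digraph_on m E))) p \<and> 3 \<le> length p) \<and>
     (\<exists>!v. v \<in> {1..m} \<and> in_degree (digraph_on m E) v = 0)"

text \<open>Paths are lists of edges, so \<open>length\<close> is the number of edges.\<close>

abbreviation dpath :: "nat \<Rightarrow> (nat \<times> nat) set \<Rightarrow> nat \<Rightarrow> (nat \<times> nat) list \<Rightarrow> nat \<Rightarrow> bool" where
  "dpath m E u p v \<equiv> pre_digraph.apath (digraph_on m E) u p v"

definition height :: "nat \<Rightarrow> (nat \<times> nat) set \<Rightarrow> nat" where
  "height m E = Max {length p | u p v. dpath m E u p v}"

definition treks ::
  "nat \<Rightarrow> (nat \<times> nat) set \<Rightarrow> nat \<Rightarrow> nat \<Rightarrow> ((nat \<times> nat) list \<times> (nat \<times> nat) list) set" where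
  "treks m E i j = {(P, Q). \<exists>s. dpath m E s P i \<and> dpath m E s Q j}"

definition max_trek_length :: "nat \<Rightarrow> (nat \<times> nat) set \<Rightarrow> nat" where
  "max_trek_length m E =
     Max {length P + length Q | i j P Q. (P, Q) \<in> treks m E i j}"

text \<open>Vectors with entries indexed by \<open>0, \<dots>, N\<close> are represented as functions on \<open>nat\<close> that
  vanish beyond \<open>N\<close>; their coordinatewise order is the pointwise order of functions.\<close>

definition trek_vec :: "nat \<Rightarrow> (nat \<times> nat) set \<Rightarrow> nat \<Rightarrow> nat \<Rightarrow> nat \<Rightarrow> int" where
  "trek_vec m E i j k = int (card {(P, Q) \<in> treks m E i j. length P + length Q = k})"

definition pairs :: "nat \<Rightarrow> (nat \<times> nat) set" where
  "pairs m = {(i, j). 1 \<le> i \<and> i \<le> j \<and> j \<le> m}"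

definition index_sets :: "nat \<Rightarrow> (nat \<times> nat) set set" where
  "index_sets m = {S. S \<noteq> {} \<and> S \<subseteq> pairs m}"

section \<open>The poset of coordinatewise minima\<close>

definition trek_meet :: "nat \<Rightarrow> (nat \<times> nat) set \<Rightarrow> (nat \<times> nat) set \<Rightarrow> nat \<Rightarrow> int" where
  "trek_meet m E S k = Min ((\<lambda>(i, j). trek_vec m E i j k) ` S)"

definition trek_poset :: "nat \<Rightarrow> (nat \<times> nat) set \<Rightarrow> (nat \<Rightarrow> int) set" where
  "trek_poset m E = trek_meet m E ` index_sets m"

definition vec_join :: "(nat \<Rightarrow> int) set \<Rightarrow> nat \<Rightarrow> int" where
  "vec_join A k = (if A = {} then 0 else Max ((\<lambda>s. s k) ` A))"

definition residue_vec :: "(nat \<Rightarrow> int) set \<Rightarrow> (nat \<Rightarrow> int) \<Rightarrow> nat \<Rightarrow> int" where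
  "residue_vec P s k = s k - vec_join {s' \<in> P. s' < s} k"

definition lower_cover :: "(nat \<Rightarrow> int) set \<Rightarrow> (nat \<Rightarrow> int) \<Rightarrow> (nat \<Rightarrow> int) set" where
  "lower_cover P s = {s' \<in> P. s' < s \<and> \<not> (\<exists>u\<in>P. s' < u \<and> u < s)}"

definition alt_vec :: "nat \<Rightarrow> nat \<Rightarrow> nat \<Rightarrow> int" (\<open>[_]\<^sup>_\<close> [0, 1000] 1000) where
  "[h]\<^sup>w = (\<lambda>k. if \<exists>l\<le>h. k = w + 2 * l then 1 else 0)"

section \<open>The parametrization and the linear forms\<close>

definition phi_hat ::
  "nat \<Rightarrow> (nat \<times> nat) set \<Rightarrow> real \<times> real \<Rightarrow> (nat \<times> nat) set \<Rightarrow> real" where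
  "phi_hat m E = (\<lambda>(\<omega>, l). \<lambda>S \<in> index_sets m.
     \<Sum>k = 0..max_trek_length m E. real_of_int (trek_meet m E S k) * \<omega> * l ^ k)"

definition V_phi :: "nat \<Rightarrow> (nat \<times> nat) set \<Rightarrow> ((nat \<times> nat) set \<Rightarrow> real) set" where
  "V_phi m E = zariski_closure (index_sets m) (range (phi_hat m E))"

definition I_phi :: "nat \<Rightarrow> (nat \<times> nat) set \<Rightarrow> (nat \<times> nat) set mpoly set" where
  "I_phi m E = vanishing_ideal (index_sets m) (V_phi m E)"

text \<open>The third set below is the degenerate case of the second one. An element \<open>s\<close> with
  \<open>r(s) = 0\<close> and empty lower cover is the zero vector; the terms of the absent cover elements are
  dropped, as in the convention for the empty join, and the form is \<open>z\<^sub>S\<close>. This form vanishes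
  identically on the image of the parametrization and is not a combination of the other forms.\<close>

definition linear_forms :: "nat \<Rightarrow> (nat \<times> nat) set \<Rightarrow> (nat \<times> nat) set mpoly set" where
  "linear_forms m E =
     {var S - var S' | S S'.
        S \<in> index_sets m \<and> S' \<in> index_sets m \<and> trek_meet m E S = trek_meet m E S'} \<union>
     {var S - var S\<^sub>1 - var S\<^sub>2 + var S\<^sub>3 | S S\<^sub>1 S\<^sub>2 S\<^sub>3.
        S \<in> index_sets m \<and> S\<^sub>1 \<in> index_sets m \<and> S\<^sub>2 \<in> index_sets m \<and> S\<^sub>3 \<in> index_sets m \<and>
        residue_vec (trek_poset m E) (trek_meet m E S) = (\<lambda>k. 0) \<and>
        lower_cover (trek_poset m E) (trek_meet m E S) = {trek_meet m E S\<^sub>1, trek_meet m E S\<^sub>2} \<and>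
        inf (trek_meet m E S\<^sub>1) (trek_meet m E S\<^sub>2) = trek_meet m E S\<^sub>3} \<union>
     {var S | S.
        S \<in> index_sets m \<and>
        residue_vec (trek_poset m E) (trek_meet m E S) = (\<lambda>k. 0) \<and>
        lower_cover (trek_poset m E) (trek_meet m E S) = {}}"

section \<open>The choices of index sets\<close>

text \<open>\<open>S\<close> and \<open>S'\<close> are admissible choices for the index \<open>d\<close>, where \<open>[h]\<^sup>w\<close> is the least element
  of the poset with \<open>2h + w = d\<close>. Nothing is required of \<open>S'\<close> if \<open>h = 0\<close>, where it is not used.\<close>

definition is_choice ::
  "nat \<Rightarrow> (nat \<times> nat) set \<Rightarrow> nat \<Rightarrow> nat \<Rightarrow> nat \<Rightarrow> (nat \<times> nat) set \<Rightarrow> (nat \<times> nat) set \<Rightarrow> bool"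
where
  "is_choice m E d h w S S' \<longleftrightarrow>
     2 * h + w = d \<and>
     (\<forall>h' w'. 2 * h' + w' = d \<and> [h']\<^sup>w' \<in> trek_poset m E \<longrightarrow> [h]\<^sup>w \<le> [h']\<^sup>w') \<and>
     S \<in> index_sets m \<and> trek_meet m E S = [h]\<^sup>w \<and>
     (0 < h \<longrightarrow> S' \<in> index_sets m \<and> trek_meet m E S' = [h - 1]\<^sup>w)"

definition z_diff :: "nat \<Rightarrow> (nat \<times> nat) set \<Rightarrow> (nat \<times> nat) set \<Rightarrow> (nat \<times> nat) set mpoly" where
  "z_diff h S S' = var S - (if h = 0 then 0 else var S')"

end

theory Submission
  imports Defs "HOL-Computational_Algebra.Polynomial"
begin

text \<open>A trek between \<open>i\<close> and \<open>j\<close> is determined by its top, which runs through the common ancestors of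
  \<open>i\<close> and \<open>j\<close>; hence every \<open>t(i,j)\<close> is some \<open>[h]\<^sup>w\<close>, and the poset consists of such intervals and
  possibly \<open>0\<close>. If an interval is not the least one with its top position, it has residue zero and
  exactly two lower covers, obtained by dropping the top and by moving the bottom up, so
  \<open>L\<^sub>G\<close> rewrites \<open>z\<^sub>S\<close> by induction as a linear combination of \<open>x\<^sub>0, \<dots>, x\<^sub>K\<close>, where \<open>K\<close> is twice
  the height and \<open>x\<^sub>d = z\<^bsub>S\<^sub>d\<^esub> - z\<^bsub>S'\<^sub>d\<^esub>\<close>. Since \<open>x\<^sub>d\<close> evaluates to \<open>\<omega>\<lambda>\<^sup>d\<close>, what remains is the cone over
  a rational normal curve: the quadrics reduce any product of \<open>n\<close> variables \<open>x\<^sub>d\<close> with index sum \<open>D\<close>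
  to one standard monomial depending only on \<open>(n, D)\<close>, and standard monomials take the linearly
  independent values \<open>\<omega>\<^sup>n\<lambda>\<^sup>D\<close>.\<close>

section \<open>Evaluation of polynomials\<close>

definition monom_eval :: "('v \<Rightarrow> real) \<Rightarrow> ('v \<Rightarrow>\<^sub>0 nat) \<Rightarrow> real" where
  "monom_eval a u = (\<Prod>v\<in>Poly_Mapping.keys u. a v ^ Poly_Mapping.lookup u v)"

definition Const :: "real \<Rightarrow> 'v mpoly" where
  "Const c = Poly_Mapping.single 0 c"

lemma monom_eval_superset:
  assumes "finite A" "Poly_Mapping.keys u \<subseteq> A"
  shows "monom_eval a u = (\<Prod>v\<in>A. a v ^ Poly_Mapping.lookup u v)"
  unfolding monom_eval_def
  by (rule prod.mono_neutral_left) (use assms in \<open>auto simp: in_keys_iff\<close>)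

lemma monom_eval_add: "monom_eval a (u + w) = monom_eval a u * monom_eval a w"
proof -
  let ?A = "Poly_Mapping.keys u \<union> Poly_Mapping.keys w"
  have "monom_eval a (u + w) = (\<Prod>v\<in>?A. a v ^ Poly_Mapping.lookup (u + w) v)"
    by (rule monom_eval_superset) (use Poly_Mapping.keys_add[of u w] in auto)
  also have "\<dots> = (\<Prod>v\<in>?A. a v ^ Poly_Mapping.lookup u v) * (\<Prod>v\<in>?A. a v ^ Poly_Mapping.lookup w v)"
    by (simp add: lookup_add power_add prod.distrib)
  also have "\<dots> = monom_eval a u * monom_eval a w"
    by (simp add: monom_eval_superset[of ?A])
  finally show ?thesis .
qed

lemma peval_superset:
  assumes "finite A" "Poly_Mapping.keys p \<subseteq> A"
  shows "peval a p = (\<Sum>u\<in>A. Poly_Mapping.lookup p u * monom_eval a u)"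
  unfolding peval_def monom_eval_def[symmetric]
  by (rule sum.mono_neutral_left) (use assms in \<open>auto simp: in_keys_iff\<close>)

lemma peval_0 [simp]: "peval a 0 = 0"
  by (simp add: peval_def)

lemma peval_add [simp]: "peval a (p + q) = peval a p + peval a q"
proof -
  let ?A = "Poly_Mapping.keys p \<union> Poly_Mapping.keys q"
  have "peval a (p + q) = (\<Sum>u\<in>?A. Poly_Mapping.lookup (p + q) u * monom_eval a u)"
    by (rule peval_superset) (use Poly_Mapping.keys_add[of p q] in auto)
  also have "\<dots> = peval a p + peval a q"
    by (simp add: lookup_add distrib_right sum.distrib peval_superset[of ?A])
  finally show ?thesis .
qed

lemma peval_sum: "peval a (sum f A) = (\<Sum>i\<in>A. peval a (f i))"
  by (induction A rule: infinite_finite_induct) auto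

lemma peval_uminus [simp]: "peval a (- p) = - peval a p"
  using peval_add[of a p "- p"] by simp

lemma peval_diff [simp]: "peval a (p - q) = peval a p - peval a q"
  using peval_add[of a p "- q"] by simp

lemma peval_single: "peval a (Poly_Mapping.single u c) = c * monom_eval a u"
  by (simp add: peval_superset[of "{u}"])

lemma poly_mapping_eq_sum_single:
  "p = (\<Sum>u\<in>Poly_Mapping.keys p. Poly_Mapping.single u (Poly_Mapping.lookup p u))"
  by (rule poly_mapping_eqI)
    (auto simp: lookup_sum lookup_single when_def in_keys_iff)

lemma peval_mult [simp]: "peval a (p * q) = peval a p * peval a q"
proof -
  have "peval a (p * q) = peval a
      ((\<Sum>u\<in>Poly_Mapping.keys p. Poly_Mapping.single u (Poly_Mapping.lookup p u)) *
       (\<Sum>w\<in>Poly_Mapping.keys q. Poly_Mapping.single w (Poly_Mapping.lookup q w)))"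
    using poly_mapping_eq_sum_single[of p] poly_mapping_eq_sum_single[of q] by simp
  also have "\<dots> = (\<Sum>u\<in>Poly_Mapping.keys p. \<Sum>w\<in>Poly_Mapping.keys q.
      (Poly_Mapping.lookup p u * monom_eval a u) * (Poly_Mapping.lookup q w * monom_eval a w))"
    by (simp add: sum_product mult_single peval_sum peval_single monom_eval_add mult.assoc mult.left_commute)
  also have "\<dots> = peval a p * peval a q"
    by (simp add: sum_product[symmetric] peval_def monom_eval_def)
  finally show ?thesis .
qed

lemma peval_Const [simp]: "peval a (Const c) = c"
  by (simp add: Const_def peval_single monom_eval_def)

lemma peval_var [simp]: "peval a (var v) = a v"
  by (simp add: var_def peval_single monom_eval_def)

lemma Const_0 [simp]: "Const 0 = 0" and Const_1 [simp]: "Const 1 = 1"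
  and Const_add: "Const (b + c) = Const b + Const c"
  and Const_uminus: "Const (- c) = - Const c"
  and Const_mult: "Const (b * c) = Const b * Const c"
  by (simp_all add: Const_def single_add single_uminus mult_single)

lemma Const_carrier [simp]: "Const c \<in> carrier (poly_ring V)"
  by (simp add: Const_def poly_ring_def)

lemma zero_carrier: "0 \<in> carrier (poly_ring V)" and one_carrier: "1 \<in> carrier (poly_ring V)"
  by (simp_all add: poly_ring_def)

lemma var_carrier: "v \<in> V \<Longrightarrow> var v \<in> carrier (poly_ring V)"
  by (simp add: var_def poly_ring_def)

lemma diff_carrier:
  "p \<in> carrier (poly_ring V) \<Longrightarrow> q \<in> carrier (poly_ring V) \<Longrightarrow> p - q \<in> carrier (poly_ring V)"
  using poly_ring_closed(1)[of p V "- q"] poly_ring_closed(2)[of q V] by simp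

section \<open>Induction over monomials and polynomials\<close>

lemma monom_induct [consumes 1, case_names one mult]:
  fixes u :: "'v \<Rightarrow>\<^sub>0 nat"
  assumes "Poly_Mapping.keys u \<subseteq> V"
  assumes one: "Q 1"
  assumes step: "\<And>v p. v \<in> V \<Longrightarrow> Q p \<Longrightarrow> Q (var v * p)"
  shows "Q (Poly_Mapping.single u (1::real))"
  using assms(1)
proof (induction "\<Sum>v\<in>Poly_Mapping.keys u. Poly_Mapping.lookup u v" arbitrary: u)
  case 0
  then have "u = 0"
    by (intro poly_mapping_eqI) (auto simp: in_keys_iff)
  then show ?case
    using one by simp
next
  case (Suc n)
  then have "Poly_Mapping.keys u \<noteq> {}"
    by (metis sum.empty nat.distinct(1))
  then obtain v where v: "v \<in> Poly_Mapping.keys u"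
    by blast
  define w where "w = u - Poly_Mapping.single v 1"
  have u: "u = Poly_Mapping.single v 1 + w"
    using v by (intro poly_mapping_eqI)
      (auto simp: w_def lookup_add lookup_minus lookup_single when_def in_keys_iff)
  have keys: "Poly_Mapping.keys w \<subseteq> Poly_Mapping.keys u"
    by (auto simp: u lookup_add in_keys_iff)
  have "(\<Sum>x\<in>Poly_Mapping.keys u. Poly_Mapping.lookup u x) =
      (\<Sum>x\<in>Poly_Mapping.keys u. (if x = v then 1 else 0) + Poly_Mapping.lookup w x)"
    by (intro sum.cong) (auto simp: u lookup_add lookup_single when_def)
  also have "\<dots> = 1 + (\<Sum>x\<in>Poly_Mapping.keys u. Poly_Mapping.lookup w x)"
    using v by (simp add: sum.distrib)
  also have "(\<Sum>x\<in>Poly_Mapping.keys u. Poly_Mapping.lookup w x) =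
      (\<Sum>x\<in>Poly_Mapping.keys w. Poly_Mapping.lookup w x)"
    by (rule sum.mono_neutral_right) (use keys in \<open>auto simp: in_keys_iff\<close>)
  finally have "n = (\<Sum>x\<in>Poly_Mapping.keys w. Poly_Mapping.lookup w x)"
    using Suc.hyps(2) by simp
  then have "Q (Poly_Mapping.single w 1)"
    using Suc.hyps(1)[of w] Suc.prems keys by blast
  then have "Q (var v * Poly_Mapping.single w 1)"
    using step v Suc.prems by blast
  then show ?case
    by (subst u) (simp add: var_def mult_single)
qed

text \<open>Every polynomial is a finite sum of scaled monomials, and zero is the scalar 0 times 1.
  The step premises carry no ring membership, so a predicate that needs it must contain it.\<close>

lemma poly_induct [consumes 1, case_names one var const add]:
  assumes "f \<in> carrier (poly_ring V)"
  assumes one: "Q 1"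
  assumes step: "\<And>v p. v \<in> V \<Longrightarrow> Q p \<Longrightarrow> Q (var v * p)"
  assumes const: "\<And>c p. Q p \<Longrightarrow> Q (Const c * p)"
  assumes add: "\<And>p q. Q p \<Longrightarrow> Q q \<Longrightarrow> Q (p + q)"
  shows "Q f"
proof -
  have zero: "Q 0"
    using const[OF one, of 0] by simp
  have "Q (Poly_Mapping.single u (Poly_Mapping.lookup f u))" if "u \<in> Poly_Mapping.keys f" for u
  proof -
    have "Poly_Mapping.keys u \<subseteq> V"
      using assms(1) that by (simp add: poly_ring_def)
    then have "Q (Poly_Mapping.single u 1)"
      using one step by (rule monom_induct)
    then have "Q (Const (Poly_Mapping.lookup f u) * Poly_Mapping.single u 1)"
      by (rule const)
    then show ?thesis
      by (simp add: Const_def mult_single)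
  qed
  then have "Q (\<Sum>u\<in>X. Poly_Mapping.single u (Poly_Mapping.lookup f u))"
    if "X \<subseteq> Poly_Mapping.keys f" for X
    using that by (induction X rule: infinite_finite_induct) (auto intro: add zero)
  then show ?thesis
    using poly_mapping_eq_sum_single[of f] by (metis order_refl)
qed

section \<open>Vanishing ideals and the passage to the Zariski closure\<close>

lemma ideal_vanishing_ideal: "ideal (vanishing_ideal V A) (poly_ring V)"
proof (rule idealI)
  interpret cring "poly_ring V"
    by (rule cring_poly_ring)
  show "ring (poly_ring V)"
    by (rule ring_axioms)
  show "subgroup (vanishing_ideal V A) (add_monoid (poly_ring V))"
  proof (rule add.subgroupI)
    show "vanishing_ideal V A \<subseteq> carrier (poly_ring V)"
      by (auto simp: vanishing_ideal_def)
    have "0 \<in> vanishing_ideal V A"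
      by (simp add: vanishing_ideal_def zero_carrier)
    then show "vanishing_ideal V A \<noteq> {}"
      by blast
    show "\<ominus>\<^bsub>poly_ring V\<^esub> p \<in> vanishing_ideal V A" if "p \<in> vanishing_ideal V A" for p
    proof -
      have p: "p \<in> carrier (poly_ring V)"
        using that by (simp add: vanishing_ideal_def)
      have "\<ominus>\<^bsub>poly_ring V\<^esub> p = - p"
        using p poly_ring_closed(2)[OF p p] by (intro minus_equality) simp_all
      then show ?thesis
        using that poly_ring_closed(2)[OF p p] by (simp add: vanishing_ideal_def)
    qed
  qed (auto simp: vanishing_ideal_def poly_ring_closed)
qed (auto simp: vanishing_ideal_def poly_ring_closed)

text \<open>The closure only adds points at which every polynomial of the ideal vanishes, so no
  equation is lost.\<close>

lemma vanishing_ideal_zariski_closure: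
  assumes "A \<subseteq> V \<rightarrow>\<^sub>E UNIV"
  shows "vanishing_ideal V (zariski_closure V A) = vanishing_ideal V A"
proof
  have "A \<subseteq> zariski_closure V A"
    using assms by (auto simp: zariski_closure_def vanishing_ideal_def)
  then show "vanishing_ideal V (zariski_closure V A) \<subseteq> vanishing_ideal V A"
    by (auto simp: vanishing_ideal_def)
  show "vanishing_ideal V A \<subseteq> vanishing_ideal V (zariski_closure V A)"
    by (auto simp: vanishing_ideal_def zariski_closure_def)
qed

section \<open>The ideal of the cone over a rational normal curve\<close>

locale poly_ideal =
  fixes V :: "'v set" and J :: "'v mpoly set"
  assumes ideal: "ideal J (poly_ring V)"
begin

lemma ideal_mult: "r \<in> carrier (poly_ring V) \<Longrightarrow> p \<in> J \<Longrightarrow> r * p \<in> J"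
  using ideal.I_l_closed[OF ideal, of p r] by simp

lemma ideal_add: "p \<in> J \<Longrightarrow> q \<in> J \<Longrightarrow> p + q \<in> J"
  using additive_subgroup.a_closed[OF ideal.axioms(1)[OF ideal], of p q] by simp

lemma ideal_zero: "0 \<in> J"
  using additive_subgroup.zero_closed[OF ideal.axioms(1)[OF ideal]] by simp

lemma ideal_uminus: "p \<in> J \<Longrightarrow> - p \<in> J"
  using ideal_mult[OF Const_carrier[of "- 1"], of p] by (simp add: Const_uminus)

lemma ideal_diff: "p \<in> J \<Longrightarrow> q \<in> J \<Longrightarrow> p - q \<in> J"
  using ideal_add[of p "- q"] ideal_uminus by simp

lemma cong_trans: "p - q \<in> J \<Longrightarrow> q - r \<in> J \<Longrightarrow> p - r \<in> J"
  using ideal_add[of "p - q" "q - r"] by simp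

lemma cong_mult_left: "r \<in> carrier (poly_ring V) \<Longrightarrow> p - q \<in> J \<Longrightarrow> r * p - r * q \<in> J"
  using ideal_mult[of r "p - q"] by (simp add: right_diff_distrib)

end

text \<open>\<open>x d\<close> stands for \<open>\<omega> * \<lambda> ^ d\<close>. The quadrics are,
  up to sign, the 2x2 minors of the matrix with rows \<open>x 0, ..., x (K - 1)\<close> and
  \<open>x 1, ..., x K\<close>; \<open>linear\<close> eliminates all other variables.\<close>

locale curve_ideal = poly_ideal V J for V :: "'v set" and J +
  fixes K :: nat and x :: "nat \<Rightarrow> 'v mpoly" and s :: "'v \<Rightarrow> nat \<Rightarrow> real"
  assumes x_carrier: "d \<le> K \<Longrightarrow> x d \<in> carrier (poly_ring V)"
    and minor: "\<lbrakk>1 \<le> i; i \<le> j; j \<le> K - 1\<rbrakk> \<Longrightarrow> x i * x j - x (i - 1) * x (j + 1) \<in> J"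
    and linear: "v \<in> V \<Longrightarrow> var v - (\<Sum>d\<le>K. Const (s v d) * x d) \<in> J"
begin

text \<open>The standard monomial of degree \<open>n\<close> and weight \<open>D\<close>, a product of factors \<open>x K\<close>, factors
  \<open>x 0\<close> and at most one further factor; it is meaningful for \<open>D \<le> n * K\<close> only.\<close>

fun std :: "nat \<Rightarrow> nat \<Rightarrow> 'v mpoly" where
  "std 0 D = 1"
| "std (Suc n) D = x (min D K) * std n (D - min D K)"

lemma std_carrier: "std n D \<in> carrier (poly_ring V)"
proof (induction n arbitrary: D)
  case (Suc n)
  then show ?case
    using poly_ring_closed(3)[OF x_carrier] by simp
qed (simp add: one_carrier)

text \<open>One quadric moves the two indices apart by one and preserves their sum; iterate until
  the lower index is 0 or the upper one is \<open>K\<close>.\<close>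

lemma quadratic_cong:
  assumes "i \<le> K" "j \<le> K"
  shows "x i * x j - x (i + j - min (i + j) K) * x (min (i + j) K) \<in> J"
proof -
  have *: "x i * x j - x (i + j - min (i + j) K) * x (min (i + j) K) \<in> J" if "i \<le> j" "j \<le> K" for i j
    using that
  proof (induction i arbitrary: j)
    case 0
    then show ?case
      using ideal_zero by (simp add: min_absorb1)
  next
    case (Suc i)
    show ?case
    proof (cases "j = K")
      case True
      then show ?thesis
        using ideal_zero by (simp add: min_absorb2)
    next
      case False
      then have "x (Suc i) * x j - x i * x (j + 1) \<in> J"
        using minor[of "Suc i" j] Suc.prems by simp
      from cong_trans[OF this, of "x (i + (j + 1) - min (i + (j + 1)) K) * x (min (i + (j + 1)) K)"]
      show ?thesis
        using Suc.IH[of "j + 1"] Suc.prems False by simp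
    qed
  qed
  show ?thesis
    using *[of i j] *[of j i] assms by (cases "i \<le> j") (simp_all add: ac_simps)
qed

text \<open>If \<open>K \<le> D\<close>, the leading factor \<open>x K\<close> is set aside and the
  induction hypothesis handles the rest.\<close>

lemma x_mult_std:
  assumes "i \<le> K" "D \<le> n * K"
  shows "x i * std n D - std (Suc n) (D + i) \<in> J"
  using assms
proof (induction n arbitrary: i D)
  case 0
  then show ?case
    using ideal_zero by (simp add: min_absorb1)
next
  case (Suc n)
  show ?case
  proof (cases "K \<le> D")
    case True
    have "x i * std n (D - K) - std (Suc n) (D - K + i) \<in> J"
      using Suc by auto
    from cong_mult_left[OF x_carrier[of K] this]
    have "x K * (x i * std n (D - K)) - x K * std (Suc n) (D - K + i) \<in> J"
      by simp
    moreover have "std (Suc n) D = x K * std n (D - K)"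
      using True by (simp add: min_absorb2)
    moreover have "std (Suc (Suc n)) (D + i) = x K * std (Suc n) (D - K + i)"
      using True by (subst std.simps) (simp add: min_absorb2 del: std.simps)
    ultimately show ?thesis
      by (simp only: mult.left_commute[of "x i"])
  next
    case False
    \<comment> \<open>Here \<open>D < K\<close>, so \<open>std (Suc n) D\<close> is
      \<open>x D\<close> times a power of \<open>x 0\<close>, and one use of
      \<open>quadratic_cong\<close> on \<open>x i * x D\<close> suffices.\<close>
    let ?e = "min (i + D) K"
    have e: "i + D - ?e \<le> K"
      using False Suc.prems by auto
    have "std n 0 * (x i * x D) - std n 0 * (x (i + D - ?e) * x ?e) \<in> J"
      using quadratic_cong[of i D] Suc.prems False by (intro cong_mult_left std_carrier) auto
    moreover have "std (Suc n) D = x D * std n 0"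
      using False by (simp add: min_absorb1)
    moreover have "std (Suc (Suc n)) (D + i) = x ?e * (x (i + D - ?e) * std n 0)"
      using e by (simp add: min_absorb1 add.commute[of D i])
    ultimately show ?thesis
      by (simp only: ac_simps)
  qed
qed

section \<open>Reduction to combinations of standard monomials\<close>

definition spanned :: "'v mpoly \<Rightarrow> bool" where
  "spanned p \<longleftrightarrow> (\<exists>F c. finite F \<and> F \<subseteq> {(n, D). D \<le> n * K} \<and>
     p - (\<Sum>(n, D)\<in>F. Const (c (n, D)) * std n D) \<in> J)"

lemma spanned_cong:
  assumes "spanned q" "p - q \<in> J"
  shows "spanned p"
  using assms cong_trans unfolding spanned_def by meson

lemma spanned_std: "D \<le> n * K \<Longrightarrow> spanned (std n D)"
  unfolding spanned_def
  by (intro exI[of _ "{(n, D)}"] exI[of _ "\<lambda>_. 1"]) (simp add: ideal_zero)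

lemma spanned_const_mult:
  assumes "spanned p"
  shows "spanned (Const a * p)"
proof -
  obtain F c where F: "finite F" "F \<subseteq> {(n, D). D \<le> n * K}"
    and p: "p - (\<Sum>(n, D)\<in>F. Const (c (n, D)) * std n D) \<in> J"
    using assms unfolding spanned_def by blast
  have "Const a * p - Const a * (\<Sum>(n, D)\<in>F. Const (c (n, D)) * std n D) \<in> J"
    using p by (rule cong_mult_left[rotated]) simp
  then have "Const a * p - (\<Sum>(n, D)\<in>F. Const (a * c (n, D)) * std n D) \<in> J"
    by (simp add: sum_distrib_left Const_mult mult.assoc case_prod_unfold)
  then show ?thesis
    unfolding spanned_def using F by (intro exI[of _ F] exI[of _ "\<lambda>k. a * c k"]) auto
qed

lemma spanned_add:
  assumes "spanned p" "spanned q"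
  shows "spanned (p + q)"
proof -
  obtain F c where F: "finite F" "F \<subseteq> {(n, D). D \<le> n * K}"
    and p: "p - (\<Sum>(n, D)\<in>F. Const (c (n, D)) * std n D) \<in> J"
    using assms(1) unfolding spanned_def by blast
  obtain G b where G: "finite G" "G \<subseteq> {(n, D). D \<le> n * K}"
    and q: "q - (\<Sum>(n, D)\<in>G. Const (b (n, D)) * std n D) \<in> J"
    using assms(2) unfolding spanned_def by blast
  define c' where "c' k = (if k \<in> F then c k else 0)" for k
  define b' where "b' k = (if k \<in> G then b k else 0)" for k
  have "(\<Sum>(n, D)\<in>F. Const (c (n, D)) * std n D) = (\<Sum>(n, D)\<in>F \<union> G. Const (c' (n, D)) * std n D)"
    by (rule sum.mono_neutral_cong_left) (use F G in \<open>auto simp: c'_def\<close>)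
  moreover have "(\<Sum>(n, D)\<in>G. Const (b (n, D)) * std n D) = (\<Sum>(n, D)\<in>F \<union> G. Const (b' (n, D)) * std n D)"
    by (rule sum.mono_neutral_cong_left) (use F G in \<open>auto simp: b'_def\<close>)
  moreover have "(\<Sum>(n, D)\<in>F \<union> G. Const (c' (n, D) + b' (n, D)) * std n D) =
      (\<Sum>(n, D)\<in>F \<union> G. Const (c' (n, D)) * std n D) + (\<Sum>(n, D)\<in>F \<union> G. Const (b' (n, D)) * std n D)"
    by (simp add: Const_add distrib_right sum.distrib case_prod_unfold)
  ultimately have "p + q - (\<Sum>(n, D)\<in>F \<union> G. Const (c' (n, D) + b' (n, D)) * std n D) \<in> J"
    using ideal_add[OF p q] by (simp add: algebra_simps)
  then show ?thesis
    unfolding spanned_def using F G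
    by (intro exI[of _ "F \<union> G"] exI[of _ "\<lambda>k. c' k + b' k"]) auto
qed

lemma spanned_zero: "spanned 0"
  using spanned_const_mult[OF spanned_std[of 0 0], of 0] by simp

lemma spanned_sum: "(\<And>i. i \<in> A \<Longrightarrow> spanned (f i)) \<Longrightarrow> spanned (sum f A)"
  by (induction A rule: infinite_finite_induct) (auto intro: spanned_add spanned_zero)

lemma spanned_x_mult:
  assumes "i \<le> K" "spanned p"
  shows "spanned (x i * p)"
proof -
  obtain F c where F: "finite F" "F \<subseteq> {(n, D). D \<le> n * K}"
    and p: "p - (\<Sum>(n, D)\<in>F. Const (c (n, D)) * std n D) \<in> J"
    using assms(2) unfolding spanned_def by blast
  have "spanned (x i * std n D)" if "(n, D) \<in> F" for n D
  proof (rule spanned_cong[OF spanned_std x_mult_std])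
    show "D + i \<le> Suc n * K"
      using that F assms(1) by auto
  qed (use that F assms(1) in auto)
  then have "spanned (\<Sum>(n, D)\<in>F. Const (c (n, D)) * (x i * std n D))"
    by (intro spanned_sum) (auto intro: spanned_const_mult)
  moreover have "x i * p - (\<Sum>(n, D)\<in>F. Const (c (n, D)) * (x i * std n D)) \<in> J"
    using cong_mult_left[OF x_carrier[OF assms(1)] p]
    by (simp add: sum_distrib_left case_prod_unfold mult.left_commute)
  ultimately show ?thesis
    by (rule spanned_cong)
qed

text \<open>Each variable is replaced through \<open>linear\<close> by a combination of the
  \<open>x d\<close>. Ring membership is carried along because that congruence gets multiplied by
  \<open>p\<close>.\<close>

lemma spanned_carrier:
  assumes "f \<in> carrier (poly_ring V)"
  shows "f \<in> carrier (poly_ring V) \<and> spanned f"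
  using assms
proof (induction rule: poly_induct)
  case one
  then show ?case
    using spanned_std[of 0 0] by (simp add: one_carrier)
next
  case (var v p)
  have "p * var v - p * (\<Sum>d\<le>K. Const (s v d) * x d) \<in> J"
    using var linear by (intro cong_mult_left) auto
  then have "var v * p - (\<Sum>d\<le>K. Const (s v d) * (x d * p)) \<in> J"
    by (simp add: sum_distrib_left ac_simps)
  moreover have "spanned (\<Sum>d\<le>K. Const (s v d) * (x d * p))"
    using var by (intro spanned_sum spanned_const_mult spanned_x_mult) auto
  ultimately have "spanned (var v * p)"
    by (rule spanned_cong[rotated])
  then show ?case
    using var(1,2) poly_ring_closed(3)[OF var_carrier[OF var(1)], of p] by simp
qed (auto intro: poly_ring_closed spanned_add spanned_const_mult)

section \<open>Values and independence of the standard monomials\<close>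

lemma peval_std:
  assumes "\<And>d. d \<le> K \<Longrightarrow> peval a (x d) = w * l ^ d" "D \<le> n * K"
  shows "peval a (std n D) = w ^ n * l ^ D"
  using assms(2)
proof (induction n arbitrary: D)
  case 0
  then show ?case
    using peval_Const[of a 1] by simp
next
  case (Suc n)
  then have "peval a (std n (D - min D K)) = w ^ n * l ^ (D - min D K)"
    by (intro Suc.IH) auto
  then show ?case
    by (simp add: assms(1) power_add[symmetric])
qed

text \<open>Standard monomials of distinct degree or weight are separated by the substitution
  \<open>\<omega> = t\<^sup>B\<close>, \<open>\<lambda> = t\<close> with \<open>B\<close> larger than all weights involved.\<close>

theorem vanishing_imp_in_ideal:
  assumes eval_x: "\<And>w l d. d \<le> K \<Longrightarrow> peval (\<phi> (w, l)) (x d) = w * l ^ d"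
    and J_van: "J \<subseteq> vanishing_ideal V (range \<phi>)"
    and f: "f \<in> vanishing_ideal V (range \<phi>)"
  shows "f \<in> J"
proof -
  have "f \<in> carrier (poly_ring V)"
    using f by (simp add: vanishing_ideal_def)
  then obtain F c where F: "finite F" "F \<subseteq> {(n, D). D \<le> n * K}"
    and fF: "f - (\<Sum>(n, D)\<in>F. Const (c (n, D)) * std n D) \<in> J"
    using spanned_carrier unfolding spanned_def by blast
  have eval0: "(\<Sum>(n, D)\<in>F. c (n, D) * (w ^ n * l ^ D)) = 0" for w l
  proof -
    have "0 = peval (\<phi> (w, l)) f - peval (\<phi> (w, l)) (f - (\<Sum>(n, D)\<in>F. Const (c (n, D)) * std n D))"
      using f fF J_van by (auto simp: vanishing_ideal_def)
    also have "\<dots> = (\<Sum>(n, D)\<in>F. c (n, D) * peval (\<phi> (w, l)) (std n D))"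
      by (simp add: peval_sum case_prod_unfold)
    also have "\<dots> = (\<Sum>(n, D)\<in>F. c (n, D) * (w ^ n * l ^ D))"
      using F(2) peval_std[OF eval_x] by (intro sum.cong) auto
    finally show ?thesis
      by simp
  qed
  \<comment> \<open>\<open>insert 0\<close> keeps \<open>Max\<close> meaningful for empty
    \<open>F\<close>. Below, \<open>n\<close> and \<open>D\<close> are quotient and remainder of
    \<open>e (n, D)\<close> modulo \<open>B\<close>, so \<open>e\<close> is injective on
    \<open>F\<close>.\<close>
  define B where "B = Suc (Max (insert 0 (snd ` F)))"
  have B: "D < B" if "(n, D) \<in> F" for n D
    using that F(1) unfolding B_def less_Suc_eq_le
    by (intro Max_ge) (auto intro: image_eqI[of _ snd "(n, D)"])
  define e where "e k = fst k * B + snd k" for k :: "nat \<times> nat"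
  have inj: "k = k'" if "k \<in> F" "k' \<in> F" "e k = e k'" for k k'
  proof -
    have "snd k < B" "snd k' < B"
      using B that by (metis prod.collapse)+
    moreover from this have "e k div B = fst k" "e k mod B = snd k" "e k' div B = fst k'" "e k' mod B = snd k'"
      by (simp_all add: e_def)
    ultimately show ?thesis
      using that(3) by (metis prod_eqI)
  qed
  define P where "P = (\<Sum>k\<in>F. Polynomial.monom (c k) (e k))"
  have "poly P t = 0" for t
  proof -
    have "poly P t = (\<Sum>(n, D)\<in>F. c (n, D) * ((t ^ B) ^ n * t ^ D))"
      unfolding P_def poly_sum poly_monom
      by (intro sum.cong) (auto simp: e_def power_add power_mult[symmetric] mult.commute)
    then show ?thesis
      using eval0 by simp
  qed
  then have "P = 0"
    using poly_all_0_iff_0 by blast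
  have "c k = 0" if k: "k \<in> F" for k
  proof -
    have "0 = coeff P (e k)"
      using \<open>P = 0\<close> by simp
    also have "\<dots> = (\<Sum>k'\<in>F. if e k' = e k then c k' else 0)"
      by (simp add: P_def coeff_sum)
    also have "\<dots> = (\<Sum>k'\<in>F. if k' = k then c k' else 0)"
      using inj k by (intro sum.cong) auto
    also have "\<dots> = c k"
      using F(1) k by simp
    finally show ?thesis
      by simp
  qed
  then have "(\<Sum>(n, D)\<in>F. Const (c (n, D)) * std n D) = 0"
    by (intro sum.neutral) auto
  then show ?thesis
    using fF by simp
qed

end

section \<open>Treks in a directed tree\<close>

locale dtree =
  fixes m :: nat and E :: "(nat \<times> nat) set"
  assumes dtree: "directed_tree m E"

begin

text \<open>\<open>digraph_on m E\<close> is \<open>with_proj T\<close>; naming \<open>T\<close>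
  gives access to the walk theory of \<open>pair_wf_digraph\<close>.\<close>

definition T :: "nat pair_pre_digraph" where
  "T = \<lparr>pverts = {1..m}, parcs = E\<rparr>"

lemma T_simps [simp]: "pverts T = {1..m}" "parcs T = E"
  by (simp_all add: T_def)

lemmas directed_tree_T = dtree[unfolded directed_tree_def, folded T_def]

end

sublocale dtree \<subseteq> pair_wf_digraph T
  using directed_tree_T by (simp add: wf_digraph_wp_iff)

context dtree
begin

lemma height_T: "height m E = Max {length p | u p v. apath u p v}"
  by (simp only: height_def T_def[symmetric])

lemma treks_T: "treks m E i j = {(P, Q). \<exists>s. apath s P i \<and> apath s Q j}"
  by (simp only: treks_def T_def[symmetric])

section \<open>Walks and paths in an acyclic digraph\<close>

lemma E_subset: "E \<subseteq> {1..m} \<times> {1..m}"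
  using arc_fst_in_verts arc_snd_in_verts by fastforce

lemma finite_E: "finite E"
  using E_subset finite_subset by blast

lemma acyclic_E: "acyclic E"
  using directed_tree_T by simp

lemma awalk_trancl: "awalk u p v \<Longrightarrow> p \<noteq> [] \<Longrightarrow> (u, v) \<in> E\<^sup>+"
proof (induction p arbitrary: u)
  case (Cons e p)
  then show ?case
    by (cases "p = []"; cases e) (auto simp: awalk_simps intro: trancl_into_trancl2)
qed simp

lemma closed_awalk_Nil: "awalk u p u \<Longrightarrow> p = []"
  using awalk_trancl acyclic_E unfolding acyclic_def by blast

text \<open>A repeated vertex would split off a nonempty closed walk, against acyclicity.\<close>

lemma apath_iff_awalk: "apath u p v \<longleftrightarrow> awalk u p v"
proof
  assume w: "awalk u p v"
  show "apath u p v"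
  proof (rule ccontr)
    assume "\<not> apath u p v"
    then have "\<not> distinct (awalk_verts u p)"
      using w by (simp add: apath_def)
    then obtain r x where "0 < length r" "awalk x r x"
      using awalk_not_distinct_decomp[OF w] by blast
    then show False
      using closed_awalk_Nil by blast
  qed
qed (simp add: apath_def)

section \<open>The root and the uniqueness of walks from it\<close>

definition root :: nat where
  "root = (THE v. v \<in> {1..m} \<and> in_degree T v = 0)"

lemma root: "root \<in> {1..m}" "(u, root) \<notin> E"
  and root_unique: "\<lbrakk>v \<in> {1..m}; \<And>u. (u, v) \<notin> E\<rbrakk> \<Longrightarrow> v = root"
proof -
  \<comment> \<open>A cardinality is also 0 for an infinite set, so finiteness is needed to read
    in-degree 0 as absence of arcs.\<close>
  have fin: "finite (in_arcs T v)" for v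
    using finite_E by (simp add: in_arcs_def)
  then have deg: "in_degree T v = 0 \<longleftrightarrow> (\<forall>u. (u, v) \<notin> E)" for v
    by (auto simp: in_degree_def in_arcs_def)
  have ex: "\<exists>!v. v \<in> {1..m} \<and> in_degree T v = 0"
    using directed_tree_T by blast
  have r: "root \<in> {1..m} \<and> in_degree T root = 0"
    unfolding root_def by (rule theI'[OF ex])
  show "root \<in> {1..m}" "(u, root) \<notin> E"
    using r unfolding deg by blast+
  show "v = root" if "v \<in> {1..m}" "\<And>u. (u, v) \<notin> E"
    using ex r that unfolding deg[symmetric] by (metis deg)
qed

lemma awalk_snoc:
  assumes "awalk u p v" "(v, w) \<in> E"
  shows "awalk u (p @ [(v, w)]) w"
  using assms E_subset by (auto simp: awalk_simps)

lemma awalk_snocD: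
  assumes "awalk u (p @ [e]) w"
  shows "awalk u p (fst e)" "e \<in> E" "snd e = w"
  using assms by (auto simp: awalk_simps)

text \<open>Go up to a predecessor as long as there is one; well-foundedness ends this at a vertex
  without one, which is the root.\<close>

lemma root_awalk_exists: "v \<in> {1..m} \<Longrightarrow> \<exists>p. awalk root p v"
proof (induction v rule: wf_induct_rule[OF finite_acyclic_wf[OF finite_E acyclic_E]])
  case (1 v)
  show ?case
  proof (cases "\<exists>u. (u, v) \<in> E")
    case True
    then obtain u where u: "(u, v) \<in> E"
      by blast
    then have "u \<in> {1..m}"
      using E_subset by auto
    then obtain p where "awalk root p u"
      using "1.IH"[OF u] by auto
    then show ?thesis
      using awalk_snoc[OF _ u] by blast
  next
    case False
    then have "v = root"
      using root_unique 1 by blast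
    then show ?thesis
      using root by (intro exI[of _ "[]"]) (simp add: awalk_simps)
  qed
qed

text \<open>Two arcs into the same vertex \<open>v\<close>, together with walks from the root to their tails, which
  avoid \<open>v\<close> by acyclicity, would close up to an undirected cycle.\<close>

lemma in_arc_unique:
  assumes "(a, v) \<in> E" "(b, v) \<in> E"
  shows "a = b"
proof (rule ccontr)
  assume neq: "a \<noteq> b"
  define G' where "G' = mk_symmetric T"
  interpret S: pair_wf_digraph G'
    unfolding G'_def by (rule wellformed_mk_symmetric)
  have arcs: "parcs G' = E \<union> E\<inverse>" and verts: "pverts G' = {1..m}"
    by (auto simp: G'_def parcs_mk_symmetric)
  have fwd: "S.awalk u p w" if "awalk u p w" for u p w
    using that unfolding awalk_def S.awalk_def arcs verts by auto
  \<comment> \<open>The reversed walk visits the same vertices, so the detour through the root stays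
    away from \<open>v\<close>.\<close>
  have bwd: "\<exists>q. S.awalk w q u \<and> set (pawalk_verts w q) = set (pawalk_verts u p)"
    if "awalk u p w" for u p w
    using that
  proof (induction p arbitrary: u)
    case Nil
    then show ?case
      by (intro exI[of _ "[]"]) (auto simp: awalk_simps S.awalk_simps verts)
  next
    case (Cons e p)
    obtain x y where e: "e = (x, y)"
      by (cases e)
    have p: "awalk y p w" "x = u" "(u, y) \<in> E"
      using Cons.prems e by (auto simp: awalk_simps)
    obtain q where q: "S.awalk w q y" "set (pawalk_verts w q) = set (pawalk_verts y p)"
      using Cons.IH[OF p(1)] by blast
    have yu: "S.awalk y [(y, u)] u"
      using p(3) E_subset by (auto simp: S.awalk_simps arcs verts)
    then have "S.awalk w (q @ [(y, u)]) u"
      using q(1) by (rule S.awalk_appendI[rotated])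
    moreover have "y \<in> set (pawalk_verts y p)"
      using hd_in_awalk_verts(1)[OF p(1)] .
    then have "set (pawalk_verts w (q @ [(y, u)])) = insert u (set (pawalk_verts y p))"
      using S.set_awalk_verts_append[OF q(1) yu] q(2) by auto
    ultimately show ?case
      using e p(2) by (intro exI[of _ "q @ [(y, u)]"]) (simp del: S.awalk_append_iff)
  qed
  have avoid: "v \<notin> set (awalk_verts root p)" if w: "awalk root p x" and x: "(x, v) \<in> E" for p x
  proof
    assume "v \<in> set (awalk_verts root p)"
    then obtain r where "awalk v r x"
      using awalk_decomp[OF w] by blast
    then show False
      using closed_awalk_Nil awalk_snoc[OF _ x] by blast
  qed
  have "a \<in> {1..m}" "b \<in> {1..m}" "v \<in> {1..m}"
    using assms E_subset by auto
  obtain p where p: "awalk root p a"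
    using root_awalk_exists[OF \<open>a \<in> {1..m}\<close>] by blast
  obtain q where q: "awalk root q b"
    using root_awalk_exists[OF \<open>b \<in> {1..m}\<close>] by blast
  obtain p' where p': "S.awalk a p' root" "set (pawalk_verts a p') = set (pawalk_verts root p)"
    using bwd[OF p] by blast
  have pq: "S.awalk a (p' @ q) b"
    using S.awalk_appendI[OF p'(1) fwd[OF q]] .
  have "v \<notin> set (pawalk_verts a (p' @ q))"
    using S.set_awalk_verts_append[OF p'(1) fwd[OF q]] p'(2) avoid[OF p assms(1)]
      avoid[OF q assms(2)] by auto
  then have v: "v \<notin> set (pawalk_verts a (S.awalk_to_apath (p' @ q)))"
    using S.awalk_to_apath_subset[OF pq] S.set_awalk_verts[OF pq]
      S.set_awalk_verts[OF S.awalkI_apath[OF S.apath_awalk_to_apath[OF pq]]] by auto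
  define r where "r = S.awalk_to_apath (p' @ q)"
  have r: "S.apath a r b"
    unfolding r_def using pq by (rule S.apath_awalk_to_apath)
  then have rw: "S.awalk a r b" and rd: "distinct (pawalk_verts a r)"
    by (auto simp: S.apath_def)
  have "r \<noteq> []"
    using neq rw by (auto simp: S.awalk_simps)
  have bv: "S.awalk b [(b, v)] v"
    using assms \<open>v \<in> {1..m}\<close> by (auto simp: S.awalk_simps arcs verts)
  have rv: "S.awalk a (r @ [(b, v)]) v"
    by (rule S.awalk_appendI[OF rw bv])
  have cyc: "S.awalk v ((v, a) # r @ [(b, v)]) v"
    using rv assms(1) by (auto simp: S.awalk_Cons_iff arcs)
  have "pawalk_verts a (r @ [(b, v)]) = pawalk_verts a r @ [v]"
    using S.awalk_verts_append[OF rv] by simp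
  then have "distinct (tl (pawalk_verts v ((v, a) # r @ [(b, v)])))"
    using rd v by (simp add: r_def)
  then have "S.cycle ((v, a) # r @ [(b, v)])"
    using cyc by (auto simp: S.cycle_def)
  \<comment> \<open>Since \<open>a\<close> and \<open>b\<close> differ, the path between them has an
    edge; the two arcs at \<open>v\<close> bring the length to 3.\<close>
  moreover have "3 \<le> length ((v, a) # r @ [(b, v)])"
    using \<open>r \<noteq> []\<close> by (cases r) auto
  ultimately show False
    using directed_tree_T unfolding G'_def by blast
qed

text \<open>Compare from the end: the last edges agree because \<open>v\<close> has only one
  in-arc.\<close>

lemma root_awalk_unique:
  assumes "awalk root p v" "awalk root q v"
  shows "p = q"
  using assms
proof (induction p arbitrary: v q rule: rev_induct)
  case Nil
  then show ?case
    using closed_awalk_Nil by (auto simp: awalk_simps)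
next
  case (snoc e p)
  note p = awalk_snocD[OF snoc.prems(1)]
  have "q \<noteq> []"
  proof
    assume "q = []"
    then have "v = root"
      using snoc.prems(2) by (auto simp: awalk_simps)
    then show False
      using closed_awalk_Nil[of root "p @ [e]"] snoc.prems(1) by simp
  qed
  then obtain q' e' where q': "q = q' @ [e']"
    by (cases q rule: rev_cases) auto
  note q = awalk_snocD[OF snoc.prems(2)[unfolded q']]
  have "fst e = fst e'"
    using in_arc_unique[of "fst e" v "fst e'"] p q by (metis prod.collapse)
  then have "e = e'"
    using p(3) q(3) by (simp add: prod_eq_iff)
  moreover have "p = q'"
    using snoc.IH[OF p(1)] q(1) \<open>fst e = fst e'\<close> by simp
  ultimately show ?case
    by (simp add: q')
qed

section \<open>Root paths, depth and height\<close>

definition root_path :: "nat \<Rightarrow> (nat \<times> nat) list" where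
  "root_path v = (THE p. awalk root p v)"

lemma root_path_eq: "awalk root p v \<Longrightarrow> root_path v = p"
  unfolding root_path_def using root_awalk_unique by blast

lemma awalk_root_path: "v \<in> {1..m} \<Longrightarrow> awalk root (root_path v) v"
  using root_awalk_exists root_path_eq by blast

text \<open>Prefixing a walk by the root path of its start gives a root walk, which is unique. Walks
  into \<open>v\<close> thus become suffixes of one list.\<close>

lemma awalk_root_append: "awalk s p v \<Longrightarrow> root_path v = root_path s @ p"
proof -
  assume p: "awalk s p v"
  then have "awalk root (root_path s) s"
    using awalk_root_path awalk_hd_in_verts by simp
  then show ?thesis
    using p by (intro root_path_eq awalk_appendI)
qed

lemma awalk_length_le: "awalk s p v \<Longrightarrow> length p \<le> length (root_path v)"
  by (simp add: awalk_root_append)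

lemma finite_path_lengths: "finite {length p | u p v. apath u p v}"
proof -
  have "{length p | u p v. apath u p v} \<subseteq> (\<Union>v\<in>{1..m}. {..length (root_path v)})"
  proof
    fix n assume "n \<in> {length p | u p v. apath u p v}"
    then obtain u p v where n: "n = length p" and p: "awalk u p v"
      unfolding apath_iff_awalk by blast
    then show "n \<in> (\<Union>v\<in>{1..m}. {..length (root_path v)})"
      using awalk_length_le[OF p] awalk_last_in_verts[OF p] by (intro UN_I[of v]) simp_all
  qed
  then show ?thesis
    by (rule finite_subset) auto
qed

lemma apath_le_height: "apath u p v \<Longrightarrow> length p \<le> height m E"
  unfolding height_T by (rule Max_ge[OF finite_path_lengths]) blast

lemma root_path_le_height: "v \<in> {1..m} \<Longrightarrow> length (root_path v) \<le> height m E"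
  using apath_le_height awalk_root_path apath_iff_awalk by blast

text \<open>The end of a longest path has a root path at least as long, and the height bounds that
  from above.\<close>

lemma deepest_vertex_exists: "\<exists>v\<in>{1..m}. length (root_path v) = height m E"
proof -
  have "apath root [] root"
    using root by (auto simp: apath_simps)
  then have "{length p | u p v. apath u p v} \<noteq> {}"
    by blast
  from Max_in[OF finite_path_lengths this] obtain u p v
    where p: "apath u p v" "length p = height m E"
    unfolding height_T by auto
  then have "v \<in> {1..m}" "height m E \<le> length (root_path v)"
    using awalk_length_le[of u p v] awalk_last_in_verts[of u p v] by (simp_all add: apath_iff_awalk)
  then show ?thesis
    using root_path_le_height by (meson le_antisym)
qed

lemma vertex_exists_depth:
  assumes "v \<in> {1..m}" "a \<le> length (root_path v)"
  shows "\<exists>u\<in>{1..m}. root_path u = take a (root_path v)"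
proof -
  have "awalk root (take a (root_path v) @ drop a (root_path v)) v"
    using awalk_root_path[OF assms(1)] by simp
  then have *: "awalk root (take a (root_path v)) (awlast root (take a (root_path v)))"
    by (simp del: append_take_drop_id)
  show ?thesis
    using root_path_eq[OF *] awalk_last_in_verts[OF *] by auto
qed

subsection \<open>The trek vectors\<close>

text \<open>A trek is determined by the depth \<open>e\<close> of its top, a vertex lying on both root paths.\<close>

definition common_depths :: "nat \<Rightarrow> nat \<Rightarrow> nat set" where
  "common_depths i j = {e. e \<le> length (root_path i) \<and> e \<le> length (root_path j) \<and>
     take e (root_path i) = take e (root_path j)}"

text \<open>The legs of a trek with top \<open>s\<close> are what remains of the two root paths
  after the common prefix \<open>root_path s\<close>; conversely, any common prefix ends at a
  possible top.\<close>

lemma treks_conv: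
  assumes i: "i \<in> {1..m}" and j: "j \<in> {1..m}"
  shows "treks m E i j = (\<lambda>e. (drop e (root_path i), drop e (root_path j))) ` common_depths i j"
proof (intro equalityI subsetI)
  fix x assume "x \<in> treks m E i j"
  then obtain P Q s where x: "x = (P, Q)" and P: "awalk s P i" and Q: "awalk s Q j"
    by (auto simp: treks_T apath_iff_awalk)
  have "root_path i = root_path s @ P" "root_path j = root_path s @ Q"
    using awalk_root_append P Q by blast+
  then show "x \<in> (\<lambda>e. (drop e (root_path i), drop e (root_path j))) ` common_depths i j"
    unfolding x by (intro image_eqI[of _ _ "length (root_path s)"]) (auto simp: common_depths_def)
next
  fix x assume "x \<in> (\<lambda>e. (drop e (root_path i), drop e (root_path j))) ` common_depths i j"
  then obtain e where e: "e \<in> common_depths i j" "x = (drop e (root_path i), drop e (root_path j))"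
    by blast
  have "awalk root (take e (root_path v) @ drop e (root_path v)) v" if "v \<in> {1..m}" for v
    using awalk_root_path[OF that] by simp
  then have *: "awalk (awlast root (take e (root_path v))) (drop e (root_path v)) v"
    if "v \<in> {1..m}" for v
    using that by (simp del: append_take_drop_id)
  show "x \<in> treks m E i j"
    using *[OF i] *[OF j] e by (auto simp: treks_T apath_iff_awalk common_depths_def)
qed

text \<open>Agreement of prefixes passes to shorter prefixes and holds at 0. The maximum is the
  depth of the lowest common ancestor.\<close>

lemma common_depths_conv: "common_depths i j = {..Max (common_depths i j)}"
  and Max_common_depths: "Max (common_depths i j) \<le> length (root_path i)"
    "Max (common_depths i j) \<le> length (root_path j)"
proof -
  have "common_depths i j \<subseteq> {..length (root_path i)}"
    by (auto simp: common_depths_def)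
  then have fin: "finite (common_depths i j)"
    using finite_subset by blast
  have "0 \<in> common_depths i j"
    by (simp add: common_depths_def)
  then have mx: "Max (common_depths i j) \<in> common_depths i j"
    using Max_in[OF fin] by blast
  have "e \<in> common_depths i j" if "e \<le> Max (common_depths i j)" for e
  proof -
    define M where "M = Max (common_depths i j)"
    have "take M (root_path i) = take M (root_path j)" "e \<le> M"
      using mx that by (auto simp: common_depths_def M_def)
    then have "take e (take M (root_path i)) = take e (take M (root_path j))"
      by simp
    then have "take e (root_path i) = take e (root_path j)"
      using \<open>e \<le> M\<close> by (simp add: min_absorb1)
    then show ?thesis
      using mx that by (auto simp: common_depths_def)
  qed
  then show "common_depths i j = {..Max (common_depths i j)}"
    using Max_ge[OF fin] by auto
  show "Max (common_depths i j) \<le> length (root_path i)" "Max (common_depths i j) \<le> length (root_path j)"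
    using mx by (auto simp: common_depths_def)
qed

text \<open>A top at depth \<open>e\<close> gives length \<open>di + dj - 2 * e\<close>, and
  different depths give different treks; so no length occurs twice, and lengths grow by 2 from the
  lowest common ancestor upwards.\<close>

lemma trek_vec_eq:
  assumes i: "i \<in> {1..m}" and j: "j \<in> {1..m}"
  defines "h \<equiv> Max (common_depths i j)"
  defines "di \<equiv> length (root_path i)" and "dj \<equiv> length (root_path j)"
  shows "trek_vec m E i j = [h]\<^sup>(di + dj - 2 * h)"
proof
  fix k
  have h: "h \<le> di" "h \<le> dj" and cd: "common_depths i j = {..h}"
    using common_depths_conv Max_common_depths by (auto simp: h_def di_def dj_def)
  define f where "f = (\<lambda>e. (drop e (root_path i), drop e (root_path j)))"
  have inj: "inj_on f {..h}"
  proof (rule inj_onI)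
    fix x y assume xy: "x \<in> {..h}" "y \<in> {..h}" "f x = f y"
    then have "length (drop x (root_path i)) = length (drop y (root_path i))"
      by (simp add: f_def)
    then show "x = y"
      using xy h by (simp add: di_def)
  qed
  have "{(P, Q) \<in> treks m E i j. length P + length Q = k} = f ` {e. e \<le> h \<and> di + dj - 2 * e = k}"
    unfolding treks_conv[OF i j] cd f_def[symmetric] using h
    by (fastforce simp: f_def di_def dj_def image_iff)
  then have *: "trek_vec m E i j k = int (card {e. e \<le> h \<and> di + dj - 2 * e = k})"
    unfolding trek_vec_def using inj by (simp add: card_image inj_on_subset subset_iff)
  show "trek_vec m E i j k = ([h]\<^sup>(di + dj - 2 * h)) k"
  proof (cases "\<exists>l\<le>h. k = di + dj - 2 * h + 2 * l")
    case True
    then obtain l where l: "l \<le> h" "k = di + dj - 2 * h + 2 * l"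
      by blast
    \<comment> \<open>\<open>l\<close> counts steps up from the lowest common ancestor.\<close>
    then have "{e. e \<le> h \<and> di + dj - 2 * e = k} = {h - l}"
      using h by auto
    then show ?thesis
      using True by (simp add: * alt_vec_def)
  next
    case False
    have "\<not> (e \<le> h \<and> di + dj - 2 * e = k)" for e
      using False[simplified, rule_format, of "h - e"] h by auto
    then have "{e. e \<le> h \<and> di + dj - 2 * e = k} = {}"
      by blast
    then show ?thesis
      using False by (simp only: * alt_vec_def) simp
  qed
qed

lemma trek_vec_alt:
  assumes "i \<in> {1..m}" "j \<in> {1..m}"
  shows "\<exists>h w. trek_vec m E i j = [h]\<^sup>w \<and> 2 * h + w \<le> 2 * height m E"
  using trek_vec_eq[OF assms] Max_common_depths[of i j] root_path_le_height[OF assms(1)]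
    root_path_le_height[OF assms(2)]
  by (intro exI conjI) (assumption, linarith)

lemma Max_common_depths_take:
  assumes "root_path i = take a p" "root_path j = take b p" "a \<le> length p" "b \<le> length p"
  shows "Max (common_depths i j) = min a b"
proof -
  have "common_depths i j = {..min a b}"
    using assms by (auto simp: common_depths_def min_def)
  then show ?thesis
    by (metis Max_eqI atMost_iff finite_atMost order_refl)
qed

text \<open>Two vertices at depths \<open>d div 2\<close> and \<open>d - d div 2\<close> of a longest path.\<close>

lemma trek_vec_central:
  assumes "d \<le> 2 * height m E"
  shows "\<exists>(i, j)\<in>pairs m. trek_vec m E i j = [d div 2]\<^sup>(d mod 2)"
proof -
  obtain v where v: "v \<in> {1..m}" "length (root_path v) = height m E"
    using deepest_vertex_exists by blast
  define a b where "a = d div 2" and "b = d - d div 2"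
  have ab: "a \<le> b" "a \<le> height m E" "b \<le> height m E" "a + b - 2 * a = d mod 2"
    using assms by (auto simp: a_def b_def) presburger+
  obtain i where i: "i \<in> {1..m}" "root_path i = take a (root_path v)"
    using vertex_exists_depth[OF v(1)] ab v(2) by metis
  obtain j where j: "j \<in> {1..m}" "root_path j = take b (root_path v)"
    using vertex_exists_depth[OF v(1)] ab v(2) by metis
  \<comment> \<open>Both orders are needed: \<open>pairs\<close> puts the smaller label first, and
    labels are unrelated to depth.\<close>
  have mx: "Max (common_depths i j) = a" "Max (common_depths j i) = a"
    using Max_common_depths_take[OF i(2) j(2)] Max_common_depths_take[OF j(2) i(2)] ab v(2) by auto
  have "trek_vec m E i j = [a]\<^sup>(d mod 2)" "trek_vec m E j i = [a]\<^sup>(d mod 2)"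
    using trek_vec_eq[OF i(1) j(1)] trek_vec_eq[OF j(1) i(1)] mx i(2) j(2) ab v(2)
    by (simp_all add: add.commute)
  moreover have "(i, j) \<in> pairs m \<or> (j, i) \<in> pairs m"
    using i(1) j(1) by (auto simp: pairs_def)
  ultimately show ?thesis
    unfolding a_def by blast
qed

text \<open>The root path of a deepest vertex, taken as both legs, is a trek. Hence the sum in
  \<open>phi_hat\<close> reaches all positions up to \<open>2 * height m E\<close>.\<close>

lemma height_le_max_trek_length: "2 * height m E \<le> max_trek_length m E"
proof -
  have "{length P + length Q | i j P Q. (P, Q) \<in> treks m E i j} \<subseteq> {..2 * height m E}"
  proof
    fix n assume "n \<in> {length P + length Q | i j P Q. (P, Q) \<in> treks m E i j}"
    then obtain i j s P Q where "n = length P + length Q" "apath s P i" "apath s Q j"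
      unfolding treks_T by blast
    then show "n \<in> {..2 * height m E}"
      using apath_le_height[of s P i] apath_le_height[of s Q j] by simp
  qed
  then have fin: "finite {length P + length Q | i j P Q. (P, Q) \<in> treks m E i j}"
    using finite_subset by blast
  obtain v where v: "v \<in> {1..m}" "length (root_path v) = height m E"
    using deepest_vertex_exists by blast
  then have "(root_path v, root_path v) \<in> treks m E v v"
    using awalk_root_path apath_iff_awalk by (auto simp: treks_T)
  then have "length (root_path v) + length (root_path v) \<in> 
      {length P + length Q | i j P Q. (P, Q) \<in> treks m E i j}"
    by blast
  from Max_ge[OF fin this] show ?thesis
    using v(2) by (simp add: max_trek_length_def)
qed

end

section \<open>The poset of coordinatewise minima\<close>

subsection \<open>Lower covers and residues in finite posets of vectors\<close>

lemma lower_cover_above: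
  assumes "finite P" "s' \<in> P" "s' < s"
  shows "\<exists>c\<in>lower_cover P s. s' \<le> c"
proof -
  obtain c where c: "c \<in> {u \<in> P. u < s}" "s' \<le> c" "\<forall>u\<in>{u \<in> P. u < s}. c \<le> u \<longrightarrow> c = u"
    using finite_has_maximal2[of "{u \<in> P. u < s}" s'] assms by auto
  then have "c \<in> lower_cover P s"
    unfolding lower_cover_def by (auto dest: less_imp_le)
  then show ?thesis
    using c(2) by blast
qed

lemma lower_cover_pairI:
  assumes "a \<in> P" "b \<in> P" "a < s" "b < s" "\<not> a \<le> b" "\<not> b \<le> a"
    and "\<And>s'. s' \<in> P \<Longrightarrow> s' < s \<Longrightarrow> s' \<le> a \<or> s' \<le> b"
  shows "lower_cover P s = {a, b}"
proof -
  have above: "u = a" if "u \<in> P" "u < s" "a \<le> u" for u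
    using assms(7)[OF that(1,2)] that(3) assms(5) by (meson order.antisym order.trans)
  have "u = b" if "u \<in> P" "u < s" "b \<le> u" for u
    using assms(7)[OF that(1,2)] that(3) assms(6) by (meson order.antisym order.trans)
  then have "a \<in> lower_cover P s" "b \<in> lower_cover P s"
    using above assms(1-4) unfolding lower_cover_def by (auto dest: less_imp_le)
  moreover have "u = a \<or> u = b" if "u \<in> lower_cover P s" for u
    using that assms(1-4) assms(7)[of u] unfolding lower_cover_def by (auto simp: le_less)
  ultimately show ?thesis
    by blast
qed

lemma residue_vec_lower_cover_empty:
  assumes "finite P" "lower_cover P s = {}"
  shows "residue_vec P s k = s k"
proof -
  have "{s' \<in> P. s' < s} = {}"
    using lower_cover_above[OF assms(1)] assms(2) by blast
  then show ?thesis
    unfolding residue_vec_def vec_join_def by simp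
qed

text \<open>Every element below \<open>s\<close> lies below \<open>a\<close> or \<open>b\<close>, so
  these two already attain the join.\<close>

lemma residue_vec_lower_cover_pair:
  assumes "finite P" "lower_cover P s = {a, b}"
  shows "residue_vec P s k = s k - max (a k) (b k)"
proof -
  let ?A = "{s' \<in> P. s' < s}"
  have ab: "a \<in> ?A" "b \<in> ?A"
    using assms(2) unfolding lower_cover_def by blast+
  have "Max ((\<lambda>s. s k) ` ?A) = max (a k) (b k)"
  proof (rule Max_eqI)
    show "finite ((\<lambda>s. s k) ` ?A)"
      using assms(1) by simp
    show "max (a k) (b k) \<in> (\<lambda>s. s k) ` ?A"
      using ab by (simp add: max_def image_iff) blast
    fix y assume "y \<in> (\<lambda>s. s k) ` ?A"
    then obtain s' where s': "s' \<in> P" "s' < s" "y = s' k"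
      by blast
    then have "s' \<le> a \<or> s' \<le> b"
      using lower_cover_above[OF assms(1), of s' s] assms(2) by auto
    then show "y \<le> max (a k) (b k)"
      using s'(3) by (auto simp: le_fun_def le_max_iff_disj)
  qed
  moreover have "(?A = {}) = False"
    using ab by blast
  ultimately show ?thesis
    by (simp only: residue_vec_def vec_join_def if_False)
qed

subsection \<open>Alternating vectors as intervals\<close>

text \<open>\<open>[h]\<^sup>w\<close> described by first and last position: comparison and meet
  become inclusion and intersection of intervals of one parity.\<close>

definition iv :: "nat \<Rightarrow> nat \<Rightarrow> nat \<Rightarrow> int" where
  "iv w d = (\<lambda>k. if w \<le> k \<and> k \<le> d \<and> even (k + d) then 1 else 0)"

text \<open>Both endpoints then carry a 1, so the vector determines them.\<close>

definition proper :: "nat \<Rightarrow> nat \<Rightarrow> bool" where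
  "proper w d \<longleftrightarrow> w \<le> d \<and> even (w + d)"

lemma alt_vec_eq_iv: "[h]\<^sup>w = iv w (w + 2 * h)"
proof
  fix k
  have "(\<exists>l\<le>h. k = w + 2 * l) \<longleftrightarrow> w \<le> k \<and> k \<le> w + 2 * h \<and> even (k + (w + 2 * h))"
  proof
    assume r: "w \<le> k \<and> k \<le> w + 2 * h \<and> even (k + (w + 2 * h))"
    then have "k = w + 2 * ((k - w) div 2)"
      by presburger
    then show "\<exists>l\<le>h. k = w + 2 * l"
      using r by (intro exI[of _ "(k - w) div 2"]) auto
  qed auto
  then show "([h]\<^sup>w) k = iv w (w + 2 * h) k"
    by (simp only: alt_vec_def iv_def)
qed

lemma proper_alt: "proper w (w + 2 * h)"
  by (simp add: proper_def)

lemma iv_eq_alt_vec: "proper w d \<Longrightarrow> iv w d = [(d - w) div 2]\<^sup>w"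
proof -
  assume "proper w d"
  then have "d = w + 2 * ((d - w) div 2)"
    unfolding proper_def by presburger
  then show ?thesis
    by (simp add: alt_vec_eq_iv)
qed

lemma iv_le_iff:
  assumes "proper w d"
  shows "iv w d \<le> iv w' d' \<longleftrightarrow> w' \<le> w \<and> d \<le> d' \<and> even (d + d')"
proof
  assume le: "iv w d \<le> iv w' d'"
  have "iv w d w \<le> iv w' d' w" "iv w d d \<le> iv w' d' d"
    using le by (auto simp: le_fun_def)
  then show "w' \<le> w \<and> d \<le> d' \<and> even (d + d')"
    using assms by (auto simp: iv_def proper_def split: if_splits)
next
  assume "w' \<le> w \<and> d \<le> d' \<and> even (d + d')"
  then show "iv w d \<le> iv w' d'"
    by (auto simp: iv_def le_fun_def)
qed

lemma iv_eqD:
  assumes "proper w d" "proper w' d'" "iv w d = iv w' d'"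
  shows "w = w'" "d = d'"
  using iv_le_iff[OF assms(1), of w' d'] iv_le_iff[OF assms(2), of w d] assms(3) by auto

text \<open>Opposite parities have disjoint supports. In equal parity the intersection may be empty,
  and then \<open>iv\<close> is zero as well.\<close>

lemma inf_iv:
  "inf (iv w d) (iv w' d') = (if even (d + d') then iv (max w w') (min d d') else (\<lambda>_. 0))"
  by (rule ext, cases "d \<le> d'") (auto simp: iv_def inf_min min_absorb1 min_absorb2)

lemma iv_empty: "d < w \<Longrightarrow> iv w d = (\<lambda>_. 0)"
  by (auto simp: iv_def)

lemma iv_nonneg: "0 \<le> iv w d k"
  by (simp add: iv_def)

subsection \<open>The poset of a directed tree\<close>

lemma finite_index_sets: "finite (index_sets m)" and finite_index_set: "S \<in> index_sets m \<Longrightarrow> finite S"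
proof -
  have "pairs m \<subseteq> {1..m} \<times> {1..m}"
    by (auto simp: pairs_def)
  then have "finite (pairs m)"
    using finite_subset by blast
  then show "finite (index_sets m)" "S \<in> index_sets m \<Longrightarrow> finite S"
    by (auto simp: index_sets_def intro: finite_subset)
qed

lemma trek_meet_Un:
  assumes "S \<in> index_sets m" "S' \<in> index_sets m"
  shows "trek_meet m E (S \<union> S') = inf (trek_meet m E S) (trek_meet m E S')"
    and "S \<union> S' \<in> index_sets m"
proof -
  show "trek_meet m E (S \<union> S') = inf (trek_meet m E S) (trek_meet m E S')"
  proof
    fix k
    show "trek_meet m E (S \<union> S') k = inf (trek_meet m E S) (trek_meet m E S') k"
      using finite_index_set[OF assms(1)] finite_index_set[OF assms(2)] assms
      by (simp add: trek_meet_def image_Un index_sets_def Min_Un inf_min)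
  qed
  show "S \<union> S' \<in> index_sets m"
    using assms by (auto simp: index_sets_def)
qed

lemma trek_poset_inf:
  "a \<in> trek_poset m E \<Longrightarrow> b \<in> trek_poset m E \<Longrightarrow> inf a b \<in> trek_poset m E"
  unfolding trek_poset_def by (auto simp: trek_meet_Un(1)[symmetric] intro: trek_meet_Un(2))

lemma finite_trek_poset: "finite (trek_poset m E)"
  by (simp add: trek_poset_def finite_index_sets)

lemma trek_meet_in_poset: "S \<in> index_sets m \<Longrightarrow> trek_meet m E S \<in> trek_poset m E"
  by (simp add: trek_poset_def)

context dtree
begin

abbreviation K :: nat where "K \<equiv> 2 * height m E"
abbreviation P :: "(nat \<Rightarrow> int) set" where "P \<equiv> trek_poset m E"

text \<open>A single pair gives an interval with top at most \<open>K\<close>; each further pair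
  intersects it with another one, leaving an interval of no larger top or nothing.\<close>

lemma trek_meet_cases:
  assumes "S \<in> index_sets m"
  shows "trek_meet m E S = (\<lambda>_. 0) \<or> (\<exists>w d. proper w d \<and> d \<le> K \<and> trek_meet m E S = iv w d)"
proof -
  have "finite S" "S \<noteq> {}" "S \<subseteq> pairs m"
    using assms finite_index_set by (auto simp: index_sets_def)
  then show ?thesis
  proof (induction S rule: finite_ne_induct)
    case (singleton p)
    obtain i j where p: "p = (i, j)"
      by (cases p)
    then have "i \<in> {1..m}" "j \<in> {1..m}"
      using singleton by (auto simp: pairs_def)
    then obtain h w where hw: "trek_vec m E i j = [h]\<^sup>w" "2 * h + w \<le> K"
      using trek_vec_alt by blast
    have "trek_meet m E {p} = iv w (w + 2 * h)"
      by (rule ext) (simp add: trek_meet_def p hw(1) alt_vec_eq_iv)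
    moreover have "w + 2 * h \<le> K"
      using hw(2) by simp
    ultimately show ?case
      using proper_alt[of w h] by blast
  next
    case (insert p S)
    have S: "S \<in> index_sets m" "{p} \<in> index_sets m"
      using insert by (auto simp: index_sets_def)
    obtain i j where p: "p = (i, j)"
      by (cases p)
    then have "i \<in> {1..m}" "j \<in> {1..m}"
      using insert by (auto simp: pairs_def)
    then obtain h w where hw: "trek_vec m E i j = [h]\<^sup>w" "2 * h + w \<le> K"
      using trek_vec_alt by blast
    have "trek_meet m E {p} = iv w (w + 2 * h)"
      by (rule ext) (simp add: trek_meet_def p hw(1) alt_vec_eq_iv)
    then have eq: "trek_meet m E (insert p S) = inf (iv w (w + 2 * h)) (trek_meet m E S)"
      using trek_meet_Un(1)[OF S(2,1)] by simp
    have "S \<subseteq> pairs m"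
      using insert.prems by simp
    from insert.IH[OF this] consider "trek_meet m E S = (\<lambda>_. 0)"
      | w' d' where "proper w' d'" "d' \<le> K" "trek_meet m E S = iv w' d'"
      by blast
    then show ?case
    proof cases
      case 1
      have "inf (iv w (w + 2 * h)) (\<lambda>_. 0) = (\<lambda>_. 0)"
        by (rule ext) (simp add: inf_min iv_nonneg min_absorb2)
      then show ?thesis
        using eq 1 by simp
    next
      case 2
      define u e where "u = max w w'" and "e = min (w + 2 * h) d'"
      have eq': "trek_meet m E (insert p S) = (if even (w + 2 * h + d') then iv u e else (\<lambda>_. 0))"
        using eq 2 by (simp add: inf_iv u_def e_def)
      show ?thesis
      proof (cases "even (w + 2 * h + d') \<and> u \<le> e")
        case True
        then have "proper u e" "e \<le> K"
          using 2 by (auto simp: proper_def u_def e_def max_def min_def)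
        then show ?thesis
          using True eq' by auto
      next
        case False
        then show ?thesis
          using eq' iv_empty[of e u] by auto
      qed
    qed
  qed
qed

lemma poset_cases:
  assumes "s \<in> P"
  obtains "s = (\<lambda>_. 0)" | w d where "proper w d" "d \<le> K" "s = iv w d"
  using assms trek_meet_cases unfolding trek_poset_def by blast

lemma poset_nonneg: "s \<in> P \<Longrightarrow> 0 \<le> s k"
  by (erule poset_cases) (auto simp: iv_nonneg)

lemma iv_top_le: "iv w d \<in> P \<Longrightarrow> proper w d \<Longrightarrow> d \<le> K"
proof -
  assume P: "iv w d \<in> P" and pr: "proper w d"
  have "iv w d w \<noteq> 0"
    using pr by (simp add: iv_def proper_def)
  then show "d \<le> K"
    using P pr iv_eqD by (metis poset_cases)
qed

text \<open>This is the largest interval with top \<open>d\<close>; meets with it cut other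
  intervals off at \<open>d\<close>.\<close>

lemma central_in_poset:
  assumes "d \<le> K"
  shows "iv (d mod 2) d \<in> P"
proof -
  obtain i j where ij: "(i, j) \<in> pairs m" "trek_vec m E i j = [d div 2]\<^sup>(d mod 2)"
    using trek_vec_central[OF assms] by blast
  have "trek_meet m E {(i, j)} = iv (d mod 2) d"
    by (rule ext) (simp add: trek_meet_def ij(2) alt_vec_eq_iv)
  moreover have "{(i, j)} \<in> index_sets m"
    using ij(1) by (simp add: index_sets_def)
  ultimately show ?thesis
    using trek_meet_in_poset by metis
qed

lemma shorten_in_poset:
  assumes "iv w d \<in> P" "proper w d" "w + 2 \<le> d"
  shows "iv w (d - 2) \<in> P" "proper w (d - 2)"
proof -
  have "iv ((d - 2) mod 2) (d - 2) \<in> P"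
    using central_in_poset iv_top_le[OF assms(1,2)] by simp
  then have "inf (iv w d) (iv ((d - 2) mod 2) (d - 2)) \<in> P"
    using assms(1) trek_poset_inf by blast
  \<comment> \<open>The meet with the central interval of top \<open>d - 2\<close> must still start
    at \<open>w\<close>; for \<open>w = 0\<close> this uses that \<open>d\<close> is even.\<close>
  moreover have "(d - 2) mod 2 \<le> w"
  proof (cases "w = 0")
    case True
    then have "even (d - 2)"
      using assms(2) by (simp add: proper_def)
    then show ?thesis
      by simp
  next
    case False
    have "(d - 2) mod 2 < 2"
      by simp
    then show ?thesis
      using False by linarith
  qed
  ultimately show "iv w (d - 2) \<in> P"
    using assms(3) by (simp add: inf_iv max_def split: if_splits)
  show "proper w (d - 2)"
    using assms by (simp add: proper_def)
qed

text \<open>An element below \<open>iv w d\<close> either misses the top entry \<open>d\<close> or starts at \<open>w'\<close> or later.\<close>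

lemma lower_cover_iv:
  assumes s: "iv w d \<in> P" "proper w d"
    and w': "w < w'" "iv w' d \<in> P" "proper w' d"
    and least: "\<And>u. \<lbrakk>w < u; iv u d \<in> P; proper u d\<rbrakk> \<Longrightarrow> w' \<le> u"
  shows "lower_cover P (iv w d) = {iv w (d - 2), iv w' d}"
    and "iv w (d - 2) \<in> P" "iv w (d - 2) < iv w d" "iv w' d < iv w d"
    and "iv w d k = max (iv w (d - 2) k) (iv w' d k)"
proof -
  have d: "w + 2 \<le> d"
    using w' s(2) unfolding proper_def by presburger
  note sh = shorten_in_poset[OF s d]
  show "iv w (d - 2) \<in> P"
    by (rule sh)
  show lt: "iv w (d - 2) < iv w d" "iv w' d < iv w d"
    using d w' iv_le_iff[OF sh(2), of w d] iv_le_iff[OF s(2), of w "d - 2"]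
      iv_le_iff[OF w'(3), of w d] iv_le_iff[OF s(2), of w' d]
    by (auto simp: less_le_not_le)
  show "lower_cover P (iv w d) = {iv w (d - 2), iv w' d}"
  proof (rule lower_cover_pairI)
    show "\<not> iv w (d - 2) \<le> iv w' d" "\<not> iv w' d \<le> iv w (d - 2)"
      using iv_le_iff[OF sh(2), of w' d] iv_le_iff[OF w'(3), of w "d - 2"] w' d by auto
    fix s' assume s': "s' \<in> P" "s' < iv w d"
    from s'(1) show "s' \<le> iv w (d - 2) \<or> s' \<le> iv w' d"
    proof (cases rule: poset_cases)
      case 1
      then show ?thesis
        by (simp add: le_fun_def iv_nonneg)
    next
      case (2 u e)
      have le: "w \<le> u" "e \<le> d" "even (e + d)"
        using iv_le_iff[OF 2(1), of w d] s'(2) 2(3) by (auto simp: less_le)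
      show ?thesis
      proof (cases "e = d")
        case True
        then have "w < u"
          using s'(2) 2(3) le by (cases "u = w") auto
        then have "w' \<le> u"
          using least s'(1) 2 True by blast
        then show ?thesis
          using iv_le_iff[OF 2(1), of w' d] 2(3) True by simp
      next
        case False
        then have "e \<le> d - 2" "even (e + (d - 2))"
          using le d by presburger+
        then show ?thesis
          using iv_le_iff[OF 2(1), of w "d - 2"] le 2(3) by simp
      qed
    qed
  qed (use sh w' lt in auto)
  \<comment> \<open>The shortened interval misses only position \<open>d\<close>, where the other
    cover has a 1.\<close>
  show "iv w d k = max (iv w (d - 2) k) (iv w' d k)"
  proof (cases "k = d")
    case True
    then show ?thesis
      using w' s(2) d by (simp add: iv_def proper_def)
  next
    case False
    have "even (k + d) \<Longrightarrow> k < d \<Longrightarrow> k \<le> d - 2"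
      using False by presburger
    then show ?thesis
      using w' d False by (auto simp: iv_def)
  qed
qed

text \<open>Intervals with fixed top \<open>d\<close> form a chain growing with \<open>h\<close>, so
  the smallest \<open>h\<close> gives the least one. The central interval shows that some exist;
  shortening supplies \<open>S'\<close>.\<close>

lemma choice_exists:
  assumes "d \<le> K"
  shows "\<exists>h w S S'. is_choice m E d h w S S'"
proof -
  define Q where "Q h \<longleftrightarrow> 2 * h \<le> d \<and> [h]\<^sup>(d - 2 * h) \<in> P" for h
  have "Q (d div 2)"
  proof -
    have "d - 2 * (d div 2) = d mod 2"
      by presburger
    then show ?thesis
      using central_in_poset[OF assms] by (simp add: Q_def alt_vec_eq_iv)
  qed
  then have Q: "Q (LEAST h. Q h)"
    by (rule LeastI)
  define h w where "h = (LEAST h. Q h)" and "w = d - 2 * h"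
  have h: "2 * h + w = d" "[h]\<^sup>w \<in> P"
    using Q by (auto simp: Q_def h_def w_def)
  have least: "[h]\<^sup>w \<le> [h']\<^sup>w'" if "2 * h' + w' = d" "[h']\<^sup>w' \<in> P" for h' w'
  proof -
    have "d - 2 * h' = w'"
      using that(1) by simp
    then have "Q h'"
      using that by (simp add: Q_def)
    then have "h \<le> h'"
      unfolding h_def by (rule Least_le)
    then have "w' \<le> w" "w + 2 * h \<le> w' + 2 * h'" "even (w + 2 * h + (w' + 2 * h'))"
      using that(1) h(1) by (linarith, linarith, presburger)
    then show ?thesis
      using iv_le_iff[OF proper_alt, of w h w' "w' + 2 * h'"] by (simp add: alt_vec_eq_iv)
  qed
  obtain S where S: "S \<in> index_sets m" "trek_meet m E S = [h]\<^sup>w"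
    using h(2) unfolding trek_poset_def by auto
  have "\<exists>S'. 0 < h \<longrightarrow> S' \<in> index_sets m \<and> trek_meet m E S' = [h - 1]\<^sup>w"
  proof (cases "0 < h")
    case True
    have "w + 2 * h - 2 = w + 2 * (h - 1)"
      using True by simp
    then have "[h - 1]\<^sup>w \<in> P"
      using shorten_in_poset(1)[of w "w + 2 * h"] h(2) True proper_alt[of w h]
      by (simp add: alt_vec_eq_iv)
    then show ?thesis
      unfolding trek_poset_def by auto
  qed simp
  then show ?thesis
    unfolding is_choice_def using h(1) least S by blast
qed

section \<open>The vanishing ideal\<close>

abbreviation R where "R \<equiv> poly_ring (index_sets m)"

text \<open>The linear functional through which \<open>phi_hat\<close> depends on the meet
  vector.\<close>

definition lin :: "real \<Rightarrow> real \<Rightarrow> (nat \<Rightarrow> int) \<Rightarrow> real" where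
  "lin w l s = (\<Sum>k = 0..max_trek_length m E. real_of_int (s k) * w * l ^ k)"

lemma phi_hat_eq_lin: "S \<in> index_sets m \<Longrightarrow> phi_hat m E (w, l) S = lin w l (trek_meet m E S)"
  by (simp add: phi_hat_def lin_def)

lemma lin_diff: "lin w l s - lin w l s' = lin w l (\<lambda>k. s k - s' k)"
  by (simp add: lin_def sum_subtractf[symmetric] left_diff_distrib)

lemma lin_zero: "lin w l (\<lambda>k. 0) = 0"
  by (simp add: lin_def)

lemma lin_unit:
  assumes "d \<le> K"
  shows "lin w l (\<lambda>k. if k = d then 1 else 0) = w * l ^ d"
proof -
  have "lin w l (\<lambda>k. if k = d then 1 else 0) =
      (\<Sum>k = 0..max_trek_length m E. if k = d then w * l ^ d else 0)"
    unfolding lin_def by (intro sum.cong) auto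
  also have "\<dots> = w * l ^ d"
    using assms height_le_max_trek_length by simp
  finally show ?thesis .
qed

lemma I_phi_eq: "I_phi m E = vanishing_ideal (index_sets m) (range (phi_hat m E))"
proof -
  have "range (phi_hat m E) \<subseteq> index_sets m \<rightarrow>\<^sub>E UNIV"
    by (auto simp: phi_hat_def)
  then show ?thesis
    unfolding I_phi_def V_phi_def by (rule vanishing_ideal_zariski_closure)
qed

text \<open>Residue zero makes \<open>s\<close> the maximum of its two covers, and maximum plus
  minimum equals the sum; with an empty lower cover it makes \<open>s\<close> zero.\<close>

lemma linear_forms_subset: "linear_forms m E \<subseteq> I_phi m E"
proof
  fix p assume "p \<in> linear_forms m E"
  then consider (eq) S S' where "p = var S - var S'" "S \<in> index_sets m" "S' \<in> index_sets m"
      "trek_meet m E S = trek_meet m E S'"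
    | (cover) S S1 S2 S3 where "p = var S - var S1 - var S2 + var S3" "S \<in> index_sets m"
      "S1 \<in> index_sets m" "S2 \<in> index_sets m" "S3 \<in> index_sets m"
      "residue_vec P (trek_meet m E S) = (\<lambda>k. 0)"
      "lower_cover P (trek_meet m E S) = {trek_meet m E S1, trek_meet m E S2}"
      "inf (trek_meet m E S1) (trek_meet m E S2) = trek_meet m E S3"
    | (zero) S where "p = var S" "S \<in> index_sets m"
      "residue_vec P (trek_meet m E S) = (\<lambda>k. 0)" "lower_cover P (trek_meet m E S) = {}"
    unfolding linear_forms_def by blast
  then show "p \<in> I_phi m E"
  proof cases
    case eq
    then show ?thesis
      by (auto simp: I_phi_eq vanishing_ideal_def diff_carrier var_carrier phi_hat_eq_lin)
  next
    case cover
    have "lin w l (trek_meet m E S) - lin w l (trek_meet m E S1) - lin w l (trek_meet m E S2) +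
        lin w l (trek_meet m E S3) = 0" for w l
    proof -
      have "trek_meet m E S k - trek_meet m E S1 k - (trek_meet m E S2 k - trek_meet m E S3 k) = 0" for k
      proof -
        have "trek_meet m E S k = max (trek_meet m E S1 k) (trek_meet m E S2 k)"
          using residue_vec_lower_cover_pair[OF finite_trek_poset cover(7), of k] cover(6) by simp
        moreover have "trek_meet m E S3 k = min (trek_meet m E S1 k) (trek_meet m E S2 k)"
          unfolding cover(8)[symmetric] by (simp add: inf_min)
        ultimately show ?thesis
          by (simp add: max_def min_def)
      qed
      then have "lin w l (trek_meet m E S) - lin w l (trek_meet m E S1) -
          (lin w l (trek_meet m E S2) - lin w l (trek_meet m E S3)) = 0"
        unfolding lin_diff by (simp add: lin_zero)
      then show ?thesis
        by simp
    qed
    then show ?thesis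
      using cover by (auto simp: I_phi_eq vanishing_ideal_def diff_carrier poly_ring_closed(1)
          var_carrier phi_hat_eq_lin)
  next
    case zero
    have "trek_meet m E S = (\<lambda>k. 0)"
      using residue_vec_lower_cover_empty[OF finite_trek_poset zero(4)] zero(3) by (auto simp: fun_eq_iff)
    then show ?thesis
      using zero(1,2) by (auto simp: I_phi_eq vanishing_ideal_def var_carrier phi_hat_eq_lin lin_zero)
  qed
qed

end

lemma linear_forms_eqI:
  assumes "S \<in> index_sets m" "S' \<in> index_sets m" "trek_meet m E S = trek_meet m E S'"
  shows "var S - var S' \<in> linear_forms m E"
  unfolding linear_forms_def by (intro UnI1 CollectI exI conjI) (rule refl assms)+

lemma linear_forms_coverI:
  assumes "S \<in> index_sets m" "S1 \<in> index_sets m" "S2 \<in> index_sets m" "S3 \<in> index_sets m"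
    "residue_vec (trek_poset m E) (trek_meet m E S) = (\<lambda>k. 0)"
    "lower_cover (trek_poset m E) (trek_meet m E S) = {trek_meet m E S1, trek_meet m E S2}"
    "inf (trek_meet m E S1) (trek_meet m E S2) = trek_meet m E S3"
  shows "var S - var S1 - var S2 + var S3 \<in> linear_forms m E"
  unfolding linear_forms_def by (intro UnI1[OF UnI2] CollectI exI conjI) (rule refl assms)+

section \<open>The forms \<open>x d\<close> of a fixed choice\<close>

locale tree_choice = dtree +
  fixes h w :: "nat \<Rightarrow> nat" and S S' :: "nat \<Rightarrow> (nat \<times> nat) set"
  assumes choice: "d \<le> 2 * height m E \<Longrightarrow> is_choice m E d (h d) (w d) (S d) (S' d)"
begin

definition x :: "nat \<Rightarrow> (nat \<times> nat) set mpoly" where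
  "x d = z_diff (h d) (S d) (S' d)"

text \<open>The choice in interval form; being least with top \<open>d\<close> means having the
  largest bottom.\<close>

lemma choiceD:
  assumes "d \<le> K"
  shows "w d + 2 * h d = d" "S d \<in> index_sets m" "trek_meet m E (S d) = iv (w d) d"
    and "0 < h d \<Longrightarrow> S' d \<in> index_sets m"
    and "0 < h d \<Longrightarrow> trek_meet m E (S' d) = iv (w d) (d - 2)"
    and "proper u d \<Longrightarrow> iv u d \<in> P \<Longrightarrow> u \<le> w d"
proof -
  note c = choice[OF assms, unfolded is_choice_def]
  show eq: "w d + 2 * h d = d" and S: "S d \<in> index_sets m"
    using c by auto
  show meet: "trek_meet m E (S d) = iv (w d) d"
    using c eq by (simp add: alt_vec_eq_iv)
  show "0 < h d \<Longrightarrow> S' d \<in> index_sets m"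
    using c by blast
  assume "0 < h d"
  then have "w d + 2 * (h d - 1) = d - 2"
    using eq by simp
  then show "trek_meet m E (S' d) = iv (w d) (d - 2)"
    using c \<open>0 < h d\<close> by (simp add: alt_vec_eq_iv)
next
  note c = choice[OF assms, unfolded is_choice_def]
  assume pr: "proper u d" and P: "iv u d \<in> P"
  have "2 * ((d - u) div 2) + u = d"
    using pr unfolding proper_def by presburger
  then have "[h d]\<^sup>(w d) \<le> [(d - u) div 2]\<^sup>u"
    using c P iv_eq_alt_vec[OF pr] by metis
  then have "iv (w d) (w d + 2 * h d) \<le> iv u d"
    by (simp only: alt_vec_eq_iv[of "h d"] iv_eq_alt_vec[OF pr])
  then show "u \<le> w d"
    using iv_le_iff[OF proper_alt] by blast
qed

lemma x_carrier: "d \<le> K \<Longrightarrow> x d \<in> carrier R"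
  unfolding x_def z_diff_def
  by (auto intro!: diff_carrier var_carrier zero_carrier dest: choiceD)

text \<open>The chosen interval minus its shortening is the unit vector at \<open>d\<close>; for
  \<open>h d = 0\<close> the interval is that unit vector itself, matching the convention in
  \<open>z_diff\<close>.\<close>

lemma peval_x:
  assumes "d \<le> K"
  shows "peval (phi_hat m E (\<omega>, l)) (x d) = \<omega> * l ^ d"
proof -
  note c = choiceD[OF assms]
  define s' where "s' = (if h d = 0 then (\<lambda>_. 0) else iv (w d) (d - 2))"
  have "peval (phi_hat m E (\<omega>, l)) (x d) = lin \<omega> l (iv (w d) d) - lin \<omega> l s'"
    using c by (simp add: x_def z_diff_def phi_hat_eq_lin s'_def lin_zero)
  also have "\<dots> = lin \<omega> l (\<lambda>k. if k = d then 1 else 0)"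
  proof -
    have "iv (w d) d k - s' k = (if k = d then 1 else 0)" for k
    proof -
      have "even (k + d) \<Longrightarrow> k < d \<Longrightarrow> k \<le> d - 2"
        by presburger
      then show ?thesis
        using c(1) by (auto simp: iv_def s'_def)
    qed
    then show ?thesis
      by (simp only: lin_diff)
  qed
  finally show ?thesis
    using lin_unit[OF assms] by simp
qed

text \<open>The linear normal form of a variable with meet vector \<open>s\<close>.\<close>

definition expansion :: "(nat \<Rightarrow> int) \<Rightarrow> (nat \<times> nat) set mpoly" where
  "expansion s = (\<Sum>d\<le>K. Const (real_of_int (s d)) * x d)"

lemma expansion_add: "expansion (\<lambda>k. s k + s' k) = expansion s + expansion s'"
  by (simp add: expansion_def Const_add distrib_right sum.distrib)

lemma expansion_zero: "expansion (\<lambda>k. 0) = 0"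
  by (simp add: expansion_def)

lemma expansion_unit: "d \<le> K \<Longrightarrow> expansion (\<lambda>k. if k = d then 1 else 0) = x d"
proof -
  assume "d \<le> K"
  have "expansion (\<lambda>k. if k = d then 1 else 0) = (\<Sum>k\<le>K. if k = d then x d else 0)"
    unfolding expansion_def by (intro sum.cong) auto
  then show ?thesis
    using \<open>d \<le> K\<close> by simp
qed

text \<open>Induction along the poset: if \<open>iv w d\<close> is its least element with top \<open>d\<close>, then \<open>x d\<close> is
  the difference to \<open>iv w (d - 2)\<close>; otherwise \<open>iv w d\<close> has residue zero and its two lower covers
  give a form in \<open>linear_forms\<close>.\<close>

lemma var_expansion:
  assumes J: "ideal J R" and L: "linear_forms m E \<subseteq> J" and "U \<in> index_sets m"
  shows "var U - expansion (trek_meet m E U) \<in> J"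
  using assms(3)
proof (induction "card {s' \<in> P. s' < trek_meet m E U}" arbitrary: U rule: less_induct)
  case less
  interpret poly_ideal "index_sets m" J
    by (rule poly_ideal.intro[OF J])
  define s where "s = trek_meet m E U"
  have IH: "var U' - expansion (trek_meet m E U') \<in> J"
    if "U' \<in> index_sets m" "trek_meet m E U' < s" for U'
  proof (rule less.hyps[OF _ that(1)], rule psubset_card_mono)
    show "{s' \<in> P. s' < trek_meet m E U'} \<subset> {s' \<in> P. s' < trek_meet m E U}"
      using that trek_meet_in_poset[OF that(1)] by (auto simp: s_def)
  qed (simp add: finite_trek_poset)
  have sP: "s \<in> P"
    unfolding s_def by (rule trek_meet_in_poset) fact
  from sP show ?case
  proof (cases rule: poset_cases)
    case 1
    have "\<not> s' < s" if "s' \<in> P" for s'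
    proof -
      have "s \<le> s'"
        using poset_nonneg[OF that] 1 by (simp add: le_fun_def)
      then show ?thesis
        by (simp add: less_le_not_le)
    qed
    then have "{s' \<in> P. s' < s} = {}"
      by blast
    then have "residue_vec P s = (\<lambda>k. 0)" "lower_cover P s = {}"
      using 1 by (auto simp: residue_vec_def vec_join_def lower_cover_def)
    \<comment> \<open>The zero vector is the bottom element, and the degenerate forms contain its
      variables.\<close>
    then have "var U \<in> J"
      using L less.prems unfolding linear_forms_def s_def by blast
    then show ?thesis
      using 1 by (simp add: s_def[symmetric] expansion_zero)
  next
    case (2 u d)
    note c = choiceD[OF 2(2)]
    show ?thesis
    proof (cases "\<exists>u'>u. iv u' d \<in> P \<and> proper u' d")
      case False
      have "proper (w d) d" "iv (w d) d \<in> P"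
        using c(1) proper_alt[of "w d" "h d"] trek_meet_in_poset[OF c(2), of E] c(3) by simp_all
      \<comment> \<open>No interval of the poset with top \<open>d\<close> starts after
        \<open>u\<close>, while the chosen one starts at \<open>w d \<ge> u\<close>.\<close>
      then have u: "u = w d"
        using c(6)[OF 2(1)] sP 2(3) False by (metis le_neq_implies_less)
      then have "var U - var (S d) \<in> linear_forms m E"
        using c(3) 2(3) by (intro linear_forms_eqI less.prems c(2)) (simp add: s_def)
      then have U: "var U - var (S d) \<in> J"
        using L by blast
      have s: "s = (\<lambda>k. (if k = d then 1 else 0) + (if h d = 0 then (\<lambda>_. 0) else iv (w d) (d - 2)) k)"
      proof
        fix k
        have "even (k + d) \<Longrightarrow> k < d \<Longrightarrow> k \<le> d - 2"
          by presburger
        then show "s k = (if k = d then 1 else 0) + (if h d = 0 then (\<lambda>_. 0) else iv (w d) (d - 2)) k"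
          using c(1) 2(3) u by (auto simp: iv_def)
      qed
      show ?thesis
      proof (cases "h d = 0")
        case True
        then have "expansion s = x d"
          using s expansion_unit[OF 2(2)] by simp
        then show ?thesis
          using U True by (simp add: s_def x_def z_diff_def)
      next
        case h: False
        then have S': "S' d \<in> index_sets m" "trek_meet m E (S' d) = iv (w d) (d - 2)"
          using c by auto
        have exp: "expansion s = x d + expansion (iv (w d) (d - 2))"
          using s h expansion_add expansion_unit[OF 2(2)] by simp
        have "iv (w d) (d - 2) < s"
        proof -
          have "\<not> iv u d \<le> iv (w d) (d - 2)"
            using iv_le_iff[OF 2(1), of "w d" "d - 2"] c(1) h by auto
          moreover have "iv (w d) (d - 2) \<le> s"
            unfolding s le_fun_def using h by auto
          ultimately show ?thesis
            using 2(3) by (auto simp: less_le)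
        qed
        then have "var (S' d) - expansion (iv (w d) (d - 2)) \<in> J"
          using IH[OF S'(1)] S'(2) by simp
        from ideal_add[OF U this] show ?thesis
          using h unfolding s_def[symmetric] exp by (simp add: x_def z_diff_def algebra_simps)
      qed
    next
      case True
      \<comment> \<open>The next larger bottom yields the second lower cover.\<close>
      define u' where "u' = (LEAST u'. u < u' \<and> iv u' d \<in> P \<and> proper u' d)"
      have u': "u < u' \<and> iv u' d \<in> P \<and> proper u' d"
        unfolding u'_def using True by (rule LeastI_ex)
      have least: "u' \<le> v" if "u < v" "iv v d \<in> P" "proper v d" for v
        unfolding u'_def using that by (intro Least_le) simp
      have "iv u d \<in> P"
        using sP 2(3) by simp
      note cov = lower_cover_iv[OF this 2(1) conjunct1[OF u'] conjunct1[OF conjunct2[OF u']]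
          conjunct2[OF conjunct2[OF u']] least]
      obtain U1 where U1: "U1 \<in> index_sets m" "trek_meet m E U1 = iv u (d - 2)"
        using cov(2) unfolding trek_poset_def by auto
      obtain U2 where U2: "U2 \<in> index_sets m" "trek_meet m E U2 = iv u' d"
        using u' unfolding trek_poset_def by auto
      define U3 where "U3 = U1 \<union> U2"
      have U3: "U3 \<in> index_sets m" "trek_meet m E U3 = inf (iv u (d - 2)) (iv u' d)"
        using trek_meet_Un[OF U1(1) U2(1)] U1(2) U2(2) by (simp_all add: U3_def)
      have "residue_vec P s k = 0" for k
        using residue_vec_lower_cover_pair[OF finite_trek_poset cov(1)] cov(5) 2(3) by simp
      then have "residue_vec P s = (\<lambda>k. 0)"
        by blast
      then have "var U - var U1 - var U2 + var U3 \<in> linear_forms m E"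
        using cov(1) 2(3) U1(2) U2(2) U3(2)
        by (intro linear_forms_coverI less.prems U1(1) U2(1) U3(1)) (simp_all add: s_def[symmetric])
      then have U: "var U - var U1 - var U2 + var U3 \<in> J"
        using L by blast
      have I1: "var U1 - expansion (iv u (d - 2)) \<in> J" and I2: "var U2 - expansion (iv u' d) \<in> J"
        using IH[OF U1(1)] IH[OF U2(1)] U1(2) U2(2) cov(3,4) 2(3) by simp_all
      have "inf (iv u (d - 2)) (iv u' d) < s"
        using order.strict_trans1[OF inf_le1 cov(3)] 2(3) by simp
      then have I3: "var U3 - expansion (inf (iv u (d - 2)) (iv u' d)) \<in> J"
        using IH[OF U3(1)] U3(2) by simp
      \<comment> \<open>Maximum plus minimum of the two covers is their sum.\<close>
      have "s k + inf (iv u (d - 2)) (iv u' d) k = iv u (d - 2) k + iv u' d k" for k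
        using cov(5)[of k] 2(3) by (simp add: inf_min max_def min_def)
      then have "expansion s + expansion (inf (iv u (d - 2)) (iv u' d)) =
          expansion (iv u (d - 2)) + expansion (iv u' d)"
        by (simp only: expansion_add[symmetric])
      then have exp: "expansion s = expansion (iv u (d - 2)) + expansion (iv u' d) -
          expansion (inf (iv u (d - 2)) (iv u' d))"
        by (simp add: eq_diff_eq)
      show ?thesis
        using ideal_diff[OF ideal_add[OF ideal_add[OF U I1] I2] I3]
        unfolding s_def[symmetric] exp by (simp add: algebra_simps)
    qed
  qed
qed

text \<open>The generators vanish on the image; the other inclusion is
  \<open>vanishing_imp_in_ideal\<close>, with \<open>linear\<close> supplied by
  \<open>var_expansion\<close>.\<close>

theorem I_phi_generators:
  "I_phi m E =
     Idl\<^bsub>R\<^esub> {x i * x j - x (i - 1) * x (j + 1) | i j. 1 \<le> i \<and> i \<le> j \<and> j \<le> K - 1}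
     <+>\<^bsub>R\<^esub> Idl\<^bsub>R\<^esub> (linear_forms m E)"
proof -
  interpret cring R
    by (rule cring_poly_ring)
  define X where "X = {x i * x j - x (i - 1) * x (j + 1) | i j. 1 \<le> i \<and> i \<le> j \<and> j \<le> K - 1}"
  define J where "J = Idl\<^bsub>R\<^esub> X <+>\<^bsub>R\<^esub> Idl\<^bsub>R\<^esub> (linear_forms m E)"
  have I: "ideal (I_phi m E) R"
    unfolding I_phi_eq by (rule ideal_vanishing_ideal)
  have I_carrier: "I_phi m E \<subseteq> carrier R"
    by (auto simp: I_phi_eq vanishing_ideal_def)
  have X_vanish: "X \<subseteq> I_phi m E"
  proof
    fix p assume "p \<in> X"
    then obtain i j where p: "p = x i * x j - x (i - 1) * x (j + 1)" and ij: "1 \<le> i" "i \<le> j" "j \<le> K - 1"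
      unfolding X_def by blast
    \<comment> \<open>Since \<open>1 \<le> i\<close>, the subtraction is not truncated and both
      products have index sum \<open>i + j\<close>.\<close>
    then have le: "i \<le> K" "j \<le> K" "i - 1 \<le> K" "j + 1 \<le> K" and eq: "i + j = (i - 1) + (j + 1)"
      by auto
    have "p \<in> carrier R"
      unfolding p by (intro diff_carrier poly_ring_closed(3) x_carrier le)
    moreover have "peval (phi_hat m E (\<omega>, l)) p = 0" for \<omega> l
    proof -
      have "peval (phi_hat m E (\<omega>, l)) p = \<omega> * \<omega> * (l ^ (i + j) - l ^ ((i - 1) + (j + 1)))"
        unfolding p peval_diff peval_mult peval_x[OF le(1)] peval_x[OF le(2)] peval_x[OF le(3)]
          peval_x[OF le(4)] by (simp only: power_add right_diff_distrib ac_simps)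
      then show ?thesis
        by (simp only: eq[symmetric] diff_self mult_zero_right)
    qed
    ultimately show "p \<in> I_phi m E"
      by (auto simp: I_phi_eq vanishing_ideal_def)
  qed
  have carrier: "X \<subseteq> carrier R" "linear_forms m E \<subseteq> carrier R"
    using X_vanish[THEN subset_trans, OF I_carrier]
      linear_forms_subset[THEN subset_trans, OF I_carrier] .
  have JX: "ideal (Idl\<^bsub>R\<^esub> X) R" and JL: "ideal (Idl\<^bsub>R\<^esub> (linear_forms m E)) R"
    by (rule genideal_ideal[OF carrier(1)], rule genideal_ideal[OF carrier(2)])
  have J: "ideal J R"
    unfolding J_def by (rule add_ideals[OF JX JL])
  have zero: "0 \<in> Idl\<^bsub>R\<^esub> X" "0 \<in> Idl\<^bsub>R\<^esub> (linear_forms m E)"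
    using additive_subgroup.zero_closed[OF ideal.axioms(1)[OF JX]]
      additive_subgroup.zero_closed[OF ideal.axioms(1)[OF JL]] by simp_all
  have XJ: "X \<subseteq> J"
    using genideal_self[OF carrier(1)] zero(2) unfolding J_def set_add_def' by force
  have LJ: "linear_forms m E \<subseteq> J"
    using genideal_self[OF carrier(2)] zero(1) unfolding J_def set_add_def' by force
  have JI: "J \<subseteq> I_phi m E"
  proof
    fix p assume "p \<in> J"
    then obtain a b where "p = a + b" "a \<in> Idl\<^bsub>R\<^esub> X" "b \<in> Idl\<^bsub>R\<^esub> (linear_forms m E)"
      unfolding J_def set_add_def' by auto
    moreover have "Idl\<^bsub>R\<^esub> X \<subseteq> I_phi m E" "Idl\<^bsub>R\<^esub> (linear_forms m E) \<subseteq> I_phi m E"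
      using genideal_minimal[OF I] X_vanish linear_forms_subset by blast+
    ultimately show "p \<in> I_phi m E"
      using additive_subgroup.a_closed[OF ideal.axioms(1)[OF I], of a b] by auto
  qed
  interpret curve_ideal "index_sets m" J K x "\<lambda>U d. real_of_int (trek_meet m E U d)"
  proof (intro curve_ideal.intro poly_ideal.intro J curve_ideal_axioms.intro)
    show "x d \<in> carrier R" if "d \<le> K" for d
      using that by (rule x_carrier)
    show "x i * x j - x (i - 1) * x (j + 1) \<in> J" if "1 \<le> i" "i \<le> j" "j \<le> K - 1" for i j
      using that XJ unfolding X_def by blast
    show "var U - (\<Sum>d\<le>K. Const (real_of_int (trek_meet m E U d)) * x d) \<in> J"
      if "U \<in> index_sets m" for U
      using var_expansion[OF J LJ that] unfolding expansion_def .
  qed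
  have "I_phi m E \<subseteq> J"
    using vanishing_imp_in_ideal[of "phi_hat m E"] peval_x JI unfolding I_phi_eq by blast
  then show ?thesis
    using JI unfolding J_def X_def by blast
qed

end

text \<open>The first conjunct ensures that the quantification over choices is not vacuous.\<close>

theorem theorem7p1:
  fixes m :: nat and E :: "(nat \<times> nat) set"
  assumes "directed_tree m E"
  shows
    "(\<exists>h w S S'. \<forall>d \<le> 2 * height m E. is_choice m E d (h d) (w d) (S d) (S' d)) \<and>
     (\<forall>h w S S'. (\<forall>d \<le> 2 * height m E. is_choice m E d (h d) (w d) (S d) (S' d)) \<longrightarrow>
       (let R = poly_ring (index_sets m);
            x = (\<lambda>d. z_diff (h d) (S d) (S' d))
        in I_phi m E =
             Idl\<^bsub>R\<^esub> {x i * x j - x (i - 1) * x (j + 1) | i j.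
                     1 \<le> i \<and> i \<le> j \<and> j \<le> 2 * height m E - 1}
             <+>\<^bsub>R\<^esub> Idl\<^bsub>R\<^esub> (linear_forms m E)))"
proof (intro conjI allI impI)
  interpret dtree m E
    by unfold_locales (rule assms)
  show "\<exists>h w S S'. \<forall>d \<le> 2 * height m E. is_choice m E d (h d) (w d) (S d) (S' d)"
    using choice_exists by metis
next
  fix h w S S'
  assume "\<forall>d \<le> 2 * height m E. is_choice m E d (h d) (w d) (S d) (S' d)"
  then interpret tree_choice m E h w S S'
    using assms by unfold_locales auto
  show "let R = poly_ring (index_sets m);
            x = (\<lambda>d. z_diff (h d) (S d) (S' d))
        in I_phi m E =
             Idl\<^bsub>R\<^esub> {x i * x j - x (i - 1) * x (j + 1) | i j.
                     1 \<le> i \<and> i \<le> j \<and> j \<le> 2 * height m E - 1}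
             <+>\<^bsub>R\<^esub> Idl\<^bsub>R\<^esub> (linear_forms m E)"
    using I_phi_generators unfolding x_def Let_def .
qed

end
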